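(* Let $A$ be a positive self-adjoint linear operator on a real Hilbert space $H$ (not assumed coercive), let $V=D(A^{1/2})$, let $c>0$ and $\alpha\in(0,1)$. For every $(u_0,u_1)\in V\times H$, the unique solution $u$ of $$u''+Au+cA^{\alpha}u'=0,\qquad u(0)=u_0,\quad u'(0)=u_1,$$ satisfies $$\forall t>0,\quad u(t)\in G(A,\sigma),\qquad \sigma=\max\left\{\frac1\alpha,\frac1{1-\alpha}\right\}.$$
   Context: $|\cdot|$ and $(\cdot,\cdot)$ denote the norm and inner product of $H$. "Positive" means $(Aw,w)\ge 0$ for all $w\in D(A)$. Fractional powers $A^{\alpha}$ are defined by the spectral theorem; $V=D(A^{1/2})$ carries the graph norm of $A^{1/2}$. Solutions are understood in the energy space: $u\in C([0,\infty);V)\cap C^1([0,\infty);H)$ and, for every $w\in D(A)$, the function $t\mapsto (u'(t),w)$ is $C^1$ on $[0,\infty)$ with $\frac{d}{dt}(u'(t),w)+(u(t),Aw)+c\,(u'(t),A^{\alpha}w)=0$. For each $(u_0,u_1)\in V\times H$ there is exactly one such solution with $u(0)=u_0$, $u'(0)=u_1$. Definition (Gevrey vectors). For a positive self-adjoint operator $A$ on $H$ and $s>0$, $G(A,s)$ is the set of $u\in H$ such that $u\in D(A^n)$ for all $n\in\mathbb{N}$ and there is $R>0$ with $|A^n u|\le R^n n^{sn}$ for all integers $n\ge 1$. *)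

theory Defs
  imports "HOL-Analysis.Analysis"
begin

text \<open>
  A real Hilbert space is a type of sort \<open>{real_inner, complete_space}\<close>. An unbounded operator
  is identified with its graph, so that its domain is \<open>Domain A\<close> and its \<open>n\<close>-th power, with the
  natural domain, is the relational power \<open>A ^^ n\<close>.
\<close>

type_synonym 'h operator = "('h \<times> 'h) set"

definition app :: "'h operator \<Rightarrow> 'h \<Rightarrow> 'h" where
  "app A x = (THE y. (x, y) \<in> A)"

definition linear_operator :: "'h::real_vector operator \<Rightarrow> bool" where
  "linear_operator A \<longleftrightarrow> subspace A \<and> single_valued A"

definition adjoint_operator :: "'h::real_inner operator \<Rightarrow> 'h operator" where
  "adjoint_operator A = {(x, y). \<forall>(w, z)\<in>A. z \<bullet> x = w \<bullet> y}"

definition self_adjoint :: "'h::real_inner operator \<Rightarrow> bool" where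
  "self_adjoint A \<longleftrightarrow>
     linear_operator A \<and> closure (Domain A) = UNIV \<and> adjoint_operator A = A"

definition positive_operator :: "'h::real_inner operator \<Rightarrow> bool" where
  "positive_operator A \<longleftrightarrow> (\<forall>w\<in>Domain A. app A w \<bullet> w \<ge> 0)"


section \<open>Spectral measures and fractional powers\<close>

definition orthogonal_projection :: "('h::real_inner \<Rightarrow> 'h) \<Rightarrow> bool" where
  "orthogonal_projection P \<longleftrightarrow>
     linear P \<and> (\<forall>x. P (P x) = P x) \<and> (\<forall>x y. P x \<bullet> y = x \<bullet> P y)"

text \<open>Only the values of \<open>E\<close> on Borel sets are relevant.\<close>

definition projection_valued_measure :: "(real set \<Rightarrow> 'h::real_inner \<Rightarrow> 'h) \<Rightarrow> bool" where
  "projection_valued_measure E \<longleftrightarrow>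
     (\<forall>B\<in>sets borel. orthogonal_projection (E B)) \<and>
     E {} = (\<lambda>x. 0) \<and> E UNIV = (\<lambda>x. x) \<and>
     (\<forall>B\<in>sets borel. \<forall>C\<in>sets borel. E (B \<inter> C) = E B \<circ> E C) \<and>
     (\<forall>F :: nat \<Rightarrow> real set. range F \<subseteq> sets borel \<longrightarrow> disjoint_family F \<longrightarrow>
        (\<forall>x. (\<lambda>n. E (F n) x) sums E (\<Union>n. F n) x))"

definition scalar_measure :: "(real set \<Rightarrow> 'h::real_inner \<Rightarrow> 'h) \<Rightarrow> 'h \<Rightarrow> real measure" where
  "scalar_measure E x = measure_of UNIV (sets borel) (\<lambda>B. ennreal (E B x \<bullet> x))"

text \<open>
  The operator \<open>\<integral> f dE\<close>: its domain consists of the \<open>x\<close> with \<open>\<integral> f\<^sup>2 d(E x, x) < \<infinity>\<close>. Its value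
  \<open>y\<close> at such an \<open>x\<close> is given weakly by \<open>(y, w) = \<integral> f d(E x, w)\<close> for \<open>w\<close> in the (dense) domain,
  where the signed measure \<open>(E x, w)\<close> is expressed by polarization, as a quarter of the
  difference of the measures at \<open>x + w\<close> and \<open>x - w\<close>.
\<close>

definition spectral_domain ::
    "(real set \<Rightarrow> 'h::real_inner \<Rightarrow> 'h) \<Rightarrow> (real \<Rightarrow> real) \<Rightarrow> 'h set" where
  "spectral_domain E f = {x. integrable (scalar_measure E x) (\<lambda>l. (f l)\<^sup>2)}"

definition spectral_integral ::
    "(real set \<Rightarrow> 'h::real_inner \<Rightarrow> 'h) \<Rightarrow> (real \<Rightarrow> real) \<Rightarrow> 'h operator" where
  "spectral_integral E f = {(x, y). x \<in> spectral_domain E f \<and>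
     (\<forall>w\<in>spectral_domain E f.
        y \<bullet> w = ((LINT l|scalar_measure E (x + w). f l) - (LINT l|scalar_measure E (x - w). f l)) / 4)}"

definition is_spectral_measure_of ::
    "(real set \<Rightarrow> 'h::real_inner \<Rightarrow> 'h) \<Rightarrow> 'h operator \<Rightarrow> bool" where
  "is_spectral_measure_of E A \<longleftrightarrow>
     projection_valued_measure E \<and> A = spectral_integral E (\<lambda>l. l)"

text \<open>
  By the spectral theorem, a self-adjoint operator \<open>A\<close> on a Hilbert space has a spectral measure,
  unique on the Borel sets, and \<open>A\<^sup>a\<close> is the integral of \<open>l powr a\<close> against it. If \<open>A\<close> is
  positive, the spectral measure vanishes on the negative half-line, so the values of \<open>powr\<close> at
  negative arguments play no role. (\<open>0 powr a = 0\<close>, which is the right value for \<open>a > 0\<close>.)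
\<close>

definition frac_power :: "'h::real_inner operator \<Rightarrow> real \<Rightarrow> 'h operator" where
  "frac_power A a =
     {(x, y). \<exists>E. is_spectral_measure_of E A \<and> (x, y) \<in> spectral_integral E (\<lambda>l. l powr a)}"


section \<open>Energy solutions and Gevrey vectors\<close>

definition energy_space :: "'h::real_inner operator \<Rightarrow> 'h set" where
  "energy_space A = Domain (frac_power A (1/2))"

text \<open>
  The product norm of \<open>(x, A\<^sup>1\<^sup>/\<^sup>2 x)\<close> is the graph norm of \<open>x\<close>, so the second condition below is
  continuity of \<open>u\<close> with values in the energy space. Derivatives at \<open>0\<close> are one-sided; values of
  \<open>u\<close> at negative times are irrelevant.
\<close>

definition energy_solution ::
    "'h::real_inner operator \<Rightarrow> real \<Rightarrow> real \<Rightarrow> 'h \<Rightarrow> 'h \<Rightarrow> (real \<Rightarrow> 'h) \<Rightarrow> bool" where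
  "energy_solution A c \<alpha> u\<^sub>0 u\<^sub>1 u \<longleftrightarrow>
     (\<forall>t\<ge>0. u t \<in> energy_space A) \<and>
     continuous_on {0..} (\<lambda>t. (u t, app (frac_power A (1/2)) (u t))) \<and>
     (\<exists>u'. (\<forall>t\<ge>0. (u has_vector_derivative u' t) (at t within {0..})) \<and>
           continuous_on {0..} u' \<and>
           u 0 = u\<^sub>0 \<and> u' 0 = u\<^sub>1 \<and>
           (\<forall>w\<in>Domain A. \<exists>g.
              continuous_on {0..} g \<and>
              (\<forall>t\<ge>0. ((\<lambda>s. u' s \<bullet> w) has_real_derivative g t) (at t within {0..})) \<and>
              (\<forall>t\<ge>0. g t + u t \<bullet> app A w + c * (u' t \<bullet> app (frac_power A \<alpha>) w) = 0)))"

definition gevrey :: "'h::real_inner operator \<Rightarrow> real \<Rightarrow> 'h set" where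
  "gevrey A s = {u. (\<forall>n. u \<in> Domain (A ^^ n)) \<and>
     (\<exists>R>0. \<forall>n\<ge>1. norm (app (A ^^ n) u) \<le> R ^ n * real n powr (s * real n))}"

end

theory Submission
  imports Defs
begin

text \<open>
  Fix a spectral measure \<open>E\<close> of \<open>A\<close> and a dyadic window \<open>B = [l, 2 l)\<close> with \<open>l \<ge> 1\<close>. The component
  \<open>v = E(B) u\<close> solves \<open>v'' + S v + c R v' = 0\<close>, where \<open>S\<close> and \<open>R\<close> are the bounded symmetric parts of
  \<open>A\<close> and \<open>A\<^sup>\<alpha>\<close> in the window. With \<open>\<gamma> = min \<alpha> (1 - \<alpha>)\<close> and \<open>\<epsilon>\<close> a small multiple of \<open>l\<^sup>\<gamma>\<close>, the modified energy
  \<open>(|v'|\<^sup>2 + (S v, v)) / 2 + \<epsilon> (v, v')\<close> decays at rate \<open>2 \<epsilon> / 3\<close>, so \<open>|E(B) u(t)|\<close> is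
  \<open>O(exp (- b l\<^sup>\<gamma>))\<close> with \<open>b\<close> proportional to \<open>t\<close>. Summing \<open>l\<^sup>n exp (- b l\<^sup>\<gamma>)\<close> over the windows gives the
  Gevrey bound of order \<open>1 / \<gamma>\<close>. A spectral measure exists because \<open>u\<^sub>0\<close> lies in the energy space; its
  uniqueness is needed because \<open>frac_power\<close> is a union over all spectral measures.
\<close>

section \<open>Bounded functional calculus of a projection-valued measure\<close>

locale pvm =
  fixes E :: "real set \<Rightarrow> 'h::{real_inner, complete_space} \<Rightarrow> 'h"
  assumes pvm: "projection_valued_measure E"
begin

lemma
  assumes "B \<in> sets borel"
  shows linear_proj: "linear (E B)"
    and proj_idem: "E B (E B x) = E B x"
    and proj_sym: "E B x \<bullet> y = x \<bullet> E B y"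
  using pvm assms by (auto simp: projection_valued_measure_def orthogonal_projection_def)

lemma proj_UNIV [simp]: "E UNIV x = x" and proj_empty [simp]: "E {} x = 0"
  using pvm by (auto simp: projection_valued_measure_def)

lemma proj_Int:
  assumes "B \<in> sets borel" "C \<in> sets borel"
  shows "E B (E C x) = E (B \<inter> C) x"
  using pvm assms by (auto simp: projection_valued_measure_def)

lemma proj_sums:
  assumes "range F \<subseteq> sets borel" "disjoint_family F"
  shows "(\<lambda>n::nat. E (F n) x) sums E (\<Union>n. F n) x"
  using pvm assms by (auto simp: projection_valued_measure_def)

lemma proj_inner_self:
  assumes "B \<in> sets borel"
  shows "E B x \<bullet> x = (norm (E B x))\<^sup>2"
  by (metis assms power2_norm_eq_inner proj_idem proj_sym)

lemma norm_proj_le: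
  assumes "B \<in> sets borel"
  shows "norm (E B x) \<le> norm x"
proof -
  have "norm (E B x) * norm (E B x) \<le> norm (E B x) * norm x"
    using proj_inner_self[OF assms, of x] norm_cauchy_schwarz[of "E B x" x]
    by (simp add: power2_eq_square)
  then show ?thesis
    by (metis mult_le_cancel_left_pos norm_ge_zero not_le order.strict_trans1)
qed

lemma bounded_linear_proj:
  assumes "B \<in> sets borel"
  shows "bounded_linear (E B)"
proof -
  interpret linear "E B" by (rule linear_proj[OF assms])
  show ?thesis
    by (rule bounded_linear_intro[where K=1]) (simp_all add: add scale norm_proj_le[OF assms])
qed

lemma space_scalar [simp]: "space (scalar_measure E x) = UNIV"
  and sets_scalar [simp, measurable_cong]: "sets (scalar_measure E x) = sets borel"
  by (simp_all add: scalar_measure_def sets_measure_of_conv space_measure_of_conv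
      sets.sigma_sets_eq[of borel, simplified])

text \<open>\<open>measure_of\<close> returns the intended values only when its set function is
  countably additive. This follows from strong additivity of \<open>E\<close>, paired with
  \<open>x\<close>; the values are nonnegative because each \<open>E B\<close> is an orthogonal
  projection.\<close>

lemma emeasure_scalar:
  assumes "B \<in> sets borel"
  shows "emeasure (scalar_measure E x) B = ennreal ((norm (E B x))\<^sup>2)"
proof -
  let ?\<mu> = "\<lambda>B. ennreal (E B x \<bullet> x)"
  have "countably_additive (sets borel) ?\<mu>"
  proof (rule countably_additiveI)
    fix F :: "nat \<Rightarrow> real set"
    assume F: "range F \<subseteq> sets borel" "disjoint_family F" "(\<Union>n. F n) \<in> sets borel"
    have "(\<lambda>n. E (F n) x \<bullet> x) sums (E (\<Union>n. F n) x \<bullet> x)"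
      by (rule bounded_linear.sums[OF bounded_linear_inner_left proj_sums[OF F(1,2)]])
    moreover have "E (F n) x \<bullet> x \<ge> 0" for n
      using F(1) by (subst proj_inner_self) auto
    moreover have "E (\<Union>n. F n) x \<bullet> x \<ge> 0"
      using F(3) by (subst proj_inner_self) auto
    ultimately have "(\<lambda>n. ?\<mu> (F n)) sums ?\<mu> (\<Union>n. F n)"
      by simp
    then show "(\<Sum>n. ?\<mu> (F n)) = ?\<mu> (\<Union>n. F n)"
      by (rule sums_unique[symmetric])
  qed
  then have "emeasure (scalar_measure E x) B = ?\<mu> B"
    by (intro emeasure_measure_of[OF scalar_measure_def])
       (use assms in \<open>auto simp: positive_def\<close>)
  then show ?thesis
    by (simp add: proj_inner_self[OF assms])
qed

lemma measure_scalar: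
  assumes "B \<in> sets borel"
  shows "measure (scalar_measure E x) B = (norm (E B x))\<^sup>2"
  by (simp add: measure_def emeasure_scalar[OF assms])

lemma finite_measure_scalar: "finite_measure (scalar_measure E x)"
  by (rule finite_measureI) (simp add: emeasure_scalar)

text \<open>Pythagoras. The distance from \<open>x\<close> to a spectral subspace becomes a measure,
  so continuity and nullity of measures translate into statements about vectors.\<close>

lemma norm_diff_proj:
  assumes B: "B \<in> sets borel"
  shows "(norm (x - E B x))\<^sup>2 = measure (scalar_measure E x) (- B)"
proof -
  interpret finite_measure "scalar_measure E x" by (rule finite_measure_scalar)
  have "(norm (x - E B x))\<^sup>2 = (norm x)\<^sup>2 - (norm (E B x))\<^sup>2"
    using proj_inner_self[OF B, of x] proj_idem[OF B, of x] proj_sym[OF B, of "E B x" x]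
    by (simp add: power2_norm_eq_inner inner_diff inner_commute)
  also have "\<dots> = measure (scalar_measure E x) (- B)"
    using finite_measure_compl[of B] B by (simp add: measure_scalar Compl_eq_Diff_UNIV)
  finally show ?thesis .
qed

lemma proj_tendsto:
  assumes B: "\<And>n. B n \<in> sets borel" "incseq B" "(\<Union>n. B n) = UNIV"
  shows "(\<lambda>n. E (B n) x) \<longlonglongrightarrow> x"
proof -
  interpret finite_measure "scalar_measure E x" by (rule finite_measure_scalar)
  have "(\<lambda>n. measure (scalar_measure E x) (- B n)) \<longlonglongrightarrow> measure (scalar_measure E x) (\<Inter>n. - B n)"
    using B(1,2) by (intro finite_Lim_measure_decseq) (auto simp: decseq_def incseq_def)
  also have "(\<Inter>n. - B n) = {}"
    using B(3) by auto
  finally have "(\<lambda>n. (norm (x - E (B n) x))\<^sup>2) \<longlonglongrightarrow> 0"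
    by (simp add: norm_diff_proj[OF B(1)])
  then have "(\<lambda>n. sqrt ((norm (x - E (B n) x))\<^sup>2)) \<longlonglongrightarrow> sqrt 0"
    by (rule tendsto_real_sqrt)
  then have "(\<lambda>n. x - E (B n) x) \<longlonglongrightarrow> 0"
    by (simp add: tendsto_norm_zero_iff)
  from tendsto_diff[OF tendsto_const[of x] this] show ?thesis
    by simp
qed

text \<open>For Borel \<open>C\<close>, \<open>E (B \<inter> C) x = E C (E B x)\<close> depends only
  on \<open>E B x\<close>, so the scalar measures of \<open>x\<close> and \<open>y\<close> agree
  inside \<open>B\<close>. The densities by \<open>indicator B\<close> express this
  restriction.\<close>

lemma scalar_restrict_eq:
  fixes f :: "real \<Rightarrow> real"
  assumes B: "B \<in> sets borel" and eq: "E B x = E B y" and f: "f \<in> borel_measurable borel"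
  shows "integrable (scalar_measure E x) (\<lambda>l. indicator B l * f l) \<longleftrightarrow>
      integrable (scalar_measure E y) (\<lambda>l. indicator B l * f l)"
    and "(LINT l|scalar_measure E x. indicator B l * f l) =
      (LINT l|scalar_measure E y. indicator B l * f l)"
proof -
  have dens: "density (scalar_measure E x) (indicator B) = density (scalar_measure E y) (indicator B)"
  proof (rule measure_eqI)
    fix C assume "C \<in> sets (density (scalar_measure E x) (indicator B))"
    then have C: "C \<in> sets borel" by simp
    have "E (B \<inter> C) x = E (B \<inter> C) y"
      using proj_Int[OF C B, of x] proj_Int[OF C B, of y] eq by (simp add: Int_commute)
    then show "emeasure (density (scalar_measure E x) (indicator B)) C =
        emeasure (density (scalar_measure E y) (indicator B)) C"
      using B C by (simp add: emeasure_density flip: indicator_inter_arith) (simp add: emeasure_scalar)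
  qed simp
  have dens': "density (scalar_measure E z) (\<lambda>l. ennreal (indicator B l)) = density (scalar_measure E z) (indicator B)" for z
    by (simp add: ennreal_indicator)
  have [measurable]: "f \<in> borel_measurable (scalar_measure E z)" for z
    using f by simp
  have [measurable]: "(indicator B :: real \<Rightarrow> real) \<in> borel_measurable (scalar_measure E z)" for z
    using B by simp
  have i: "integrable (scalar_measure E z) (\<lambda>l. indicator B l * f l) \<longleftrightarrow>
      integrable (density (scalar_measure E z) (indicator B)) f" for z
    using integrable_density[of f "scalar_measure E z" "indicator B"] by (simp add: dens')
  have l: "(LINT l|scalar_measure E z. indicator B l * f l) =
      (LINT l|density (scalar_measure E z) (indicator B). f l)" for z
    using integral_density[of f "scalar_measure E z" "indicator B"] by (simp add: dens')
  show "integrable (scalar_measure E x) (\<lambda>l. indicator B l * f l) \<longleftrightarrow>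
      integrable (scalar_measure E y) (\<lambda>l. indicator B l * f l)"
    by (simp add: i dens)
  show "(LINT l|scalar_measure E x. indicator B l * f l) =
      (LINT l|scalar_measure E y. indicator B l * f l)"
    by (simp add: l dens)
qed

end

section \<open>Symmetric operators and their quadratic forms\<close>

lemma symmetric_polarization:
  fixes T :: "'h::real_inner \<Rightarrow> 'h"
  assumes "linear T" and "\<And>x y. T x \<bullet> y = x \<bullet> T y"
  shows "T x \<bullet> y = (T (x + y) \<bullet> (x + y) - T (x - y) \<bullet> (x - y)) / 4"
proof -
  interpret linear T by fact
  show ?thesis
    using assms(2)[of y x] by (simp add: add diff inner_simps inner_commute)
qed

text \<open>A bound on the quadratic form alone controls the operator: polarize
  \<open>T x \<bullet> y\<close> and apply the parallelogram identity.\<close>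

lemma symmetric_norm_bound:
  fixes T :: "'h::real_inner \<Rightarrow> 'h"
  assumes lin: "linear T" and sym: "\<And>x y. T x \<bullet> y = x \<bullet> T y"
    and M: "\<And>x. \<bar>T x \<bullet> x\<bar> \<le> M * (norm x)\<^sup>2"
  shows "norm (T x) \<le> M * norm x"
proof (cases "T x = 0 \<or> x = 0")
  case True
  have "M * (norm x)\<^sup>2 \<ge> 0" using M[of x] by linarith
  then have "M * norm x \<ge> 0"
    by (cases "x = 0") (auto simp: zero_le_mult_iff)
  then show ?thesis using True linear_0[OF lin] by auto
next
  case False
  \<comment> \<open>The multiple of \<open>T x\<close> with the norm of \<open>x\<close>: pairing it
    with \<open>T x\<close> gives \<open>norm x * norm (T x)\<close>.\<close>
  define y where "y = (norm x / norm (T x)) *\<^sub>R T x"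
  have ny: "norm y = norm x"
    using False by (simp add: y_def)
  have "4 * (T x \<bullet> y) = T (x + y) \<bullet> (x + y) - T (x - y) \<bullet> (x - y)"
    using symmetric_polarization[OF lin sym, of x y] by simp
  also have "\<dots> \<le> M * (norm (x + y))\<^sup>2 + M * (norm (x - y))\<^sup>2"
    using M[of "x + y"] M[of "x - y"] by linarith
  also have "\<dots> = M * (2 * (norm x)\<^sup>2 + 2 * (norm y)\<^sup>2)"
    by (simp add: power2_norm_eq_inner inner_simps inner_commute algebra_simps)
  also have "\<dots> = 4 * M * (norm x)\<^sup>2"
    by (simp add: ny)
  finally have "T x \<bullet> y \<le> M * (norm x)\<^sup>2" by simp
  moreover have "T x \<bullet> y = norm x * norm (T x)"
    using False by (simp add: y_def dot_square_norm power2_eq_square)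
  ultimately have "norm x * norm (T x) \<le> norm x * (M * norm x)"
    by (simp add: power2_eq_square algebra_simps)
  then show ?thesis using False by simp
qed

section \<open>Operators attached to bounded Borel functions\<close>

context pvm
begin

text \<open>Says that \<open>T\<close> is the integral of \<open>f\<close> against \<open>E\<close>,
  without signed measures: by polarization a symmetric operator is determined by its quadratic
  form.\<close>

definition represents :: "('h \<Rightarrow> 'h) \<Rightarrow> (real \<Rightarrow> real) \<Rightarrow> bool" where
  "represents T f \<longleftrightarrow> linear T \<and> (\<forall>x y. T x \<bullet> y = x \<bullet> T y) \<and>
     (\<forall>x. T x \<bullet> x = (LINT l|scalar_measure E x. f l))"

definition bounded_borel :: "(real \<Rightarrow> real) \<Rightarrow> bool" where
  "bounded_borel f \<longleftrightarrow> f \<in> borel_measurable borel \<and> (\<exists>M. \<forall>l. \<bar>f l\<bar> \<le> M)"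

lemma bounded_borel_integrable:
  assumes "bounded_borel f"
  shows "integrable (scalar_measure E x) f"
proof -
  interpret finite_measure "scalar_measure E x" by (rule finite_measure_scalar)
  obtain M where "\<And>l. \<bar>f l\<bar> \<le> M" "f \<in> borel_measurable borel"
    using assms by (auto simp: bounded_borel_def)
  then show ?thesis
    by (intro integrable_const_bound[of _ M]) auto
qed

lemma integral_scalar_bound:
  assumes f: "f \<in> borel_measurable borel" and M: "\<And>l. \<bar>f l\<bar> \<le> M"
  shows "\<bar>LINT l|scalar_measure E x. f l\<bar> \<le> M * (norm x)\<^sup>2"
proof -
  interpret finite_measure "scalar_measure E x" by (rule finite_measure_scalar)
  have i: "integrable (scalar_measure E x) f"
    using f M by (intro bounded_borel_integrable) (auto simp: bounded_borel_def)
  have "\<bar>LINT l|scalar_measure E x. f l\<bar> \<le> (LINT l|scalar_measure E x. \<bar>f l\<bar>)"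
    by (rule integral_abs_bound)
  also have "\<dots> \<le> (LINT l|scalar_measure E x. M)"
    using i M by (intro integral_mono) auto
  also have "\<dots> = M * (norm x)\<^sup>2"
    by (simp add: measure_scalar)
  finally show ?thesis .
qed

lemma represents_norm_le:
  assumes T: "represents T f" and f: "f \<in> borel_measurable borel" and M: "\<And>l. \<bar>f l\<bar> \<le> M"
  shows "norm (T x) \<le> M * norm x"
  using T integral_scalar_bound[OF f M]
  by (intro symmetric_norm_bound) (auto simp: represents_def)

lemma represents_diff:
  assumes "represents T f" "represents S g" "bounded_borel f" "bounded_borel g"
  shows "represents (\<lambda>x. T x - S x) (\<lambda>l. f l - g l)"
  using assms by (auto simp: represents_def inner_diff bounded_borel_integrable
      intro!: linear_compose_sub)

lemma represents_step:
  assumes "finite I" and B: "\<And>i. i \<in> I \<Longrightarrow> B i \<in> sets borel"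
  shows "represents (\<lambda>x. \<Sum>i\<in>I. a i *\<^sub>R E (B i) x) (\<lambda>l. \<Sum>i\<in>I. a i * indicator (B i) l)"
  unfolding represents_def
proof (intro conjI allI)
  show "linear (\<lambda>x. \<Sum>i\<in>I. a i *\<^sub>R E (B i) x)"
    by (intro linear_compose_sum ballI linear_compose_scale_right linear_proj B)
  fix x y
  show "(\<Sum>i\<in>I. a i *\<^sub>R E (B i) x) \<bullet> y = x \<bullet> (\<Sum>i\<in>I. a i *\<^sub>R E (B i) y)"
    unfolding inner_sum_left inner_sum_right using B by (intro sum.cong) (auto simp: proj_sym)
  interpret finite_measure "scalar_measure E x" by (rule finite_measure_scalar)
  have "(LINT l|scalar_measure E x. (\<Sum>i\<in>I. a i * indicator (B i) l)) =
      (\<Sum>i\<in>I. (LINT l|scalar_measure E x. a i * indicator (B i) l))"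
    using B by (intro Bochner_Integration.integral_sum)
      (auto intro!: integrable_mult_right integrable_real_indicator simp: less_top[symmetric])
  also have "\<dots> = (\<Sum>i\<in>I. a i * (norm (E (B i) x))\<^sup>2)"
    using B by (intro sum.cong) (auto simp: measure_scalar)
  also have "\<dots> = (\<Sum>i\<in>I. a i *\<^sub>R E (B i) x) \<bullet> x"
    unfolding inner_sum_left using B by (intro sum.cong) (auto simp: proj_inner_self)
  finally show "(\<Sum>i\<in>I. a i *\<^sub>R E (B i) x) \<bullet> x =
      (LINT l|scalar_measure E x. (\<Sum>i\<in>I. a i * indicator (B i) l))" ..
qed

text \<open>Step functions approximate \<open>f\<close> uniformly. By
  \<open>represents_norm_le\<close> their operators are uniformly Cauchy on bounded sets, and
  linearity, symmetry and the quadratic form pass to the pointwise limit.\<close>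

lemma represents_exists:
  assumes "bounded_borel f"
  shows "\<exists>T. represents T f"
proof -
  obtain M where f [measurable]: "f \<in> borel_measurable borel" and M: "\<And>l. \<bar>f l\<bar> \<le> M"
    using assms by (auto simp: bounded_borel_def)
  \<comment> \<open>\<open>f\<close> rounded down to the grid of mesh \<open>1 / Suc n\<close>;
    since \<open>f\<close> is bounded, only finitely many values occur.\<close>
  define s :: "nat \<Rightarrow> real \<Rightarrow> real" where "s n l = \<lfloor>real (Suc n) * f l\<rfloor> / real (Suc n)" for n l
  have s_meas [measurable]: "s n \<in> borel_measurable borel" for n
    unfolding s_def by measurable
  have s_near: "\<bar>s n l - f l\<bar> \<le> 1 / real (Suc n)" for n l
  proof -
    have "s n l - f l = (\<lfloor>real (Suc n) * f l\<rfloor> - real (Suc n) * f l) / real (Suc n)"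
      by (simp add: s_def field_simps)
    moreover have "\<bar>\<lfloor>real (Suc n) * f l\<rfloor> - real (Suc n) * f l\<bar> \<le> 1"
      by linarith
    ultimately show ?thesis
      by (simp add: divide_right_mono)
  qed
  have s_bound: "\<bar>s n l\<bar> \<le> M + 1" for n l
  proof -
    have "1 / real (Suc n) \<le> 1" by simp
    with s_near[of n l] M[of l] show ?thesis by linarith
  qed
  have s_bb: "bounded_borel (s n)" for n
    using s_bound[of n] by (auto simp: bounded_borel_def)
  have "\<exists>T. represents T (s n)" for n
  proof -
    \<comment> \<open>Large enough that \<open>{-N..N}\<close> contains every value of the floor,
      which makes \<open>s n\<close> a finite combination of indicators of its level sets
      \<open>B k\<close>.\<close>
    define N where "N = \<lceil>real (Suc n) * M\<rceil> + 1"
    define B where "B k = {l. \<lfloor>real (Suc n) * f l\<rfloor> = k}" for k :: int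
    have B: "B k \<in> sets borel" for k
      unfolding B_def by measurable
    have "s n l = (\<Sum>k\<in>{-N..N}. (real_of_int k / real (Suc n)) * indicator (B k) l)" for l
    proof -
      have "\<bar>real (Suc n) * f l\<bar> \<le> real (Suc n) * M"
        unfolding abs_mult using M[of l] by (intro mult_mono) auto
      then have "\<lfloor>real (Suc n) * f l\<rfloor> \<in> {-N..N}"
        unfolding N_def atLeastAtMost_iff by linarith
      then have "(\<Sum>k\<in>{-N..N}. (real_of_int k / real (Suc n)) * indicator (B k) l) =
          (\<Sum>k\<in>{\<lfloor>real (Suc n) * f l\<rfloor>}. (real_of_int k / real (Suc n)) * indicator (B k) l)"
        by (intro sum.mono_neutral_right) (auto simp: B_def indicator_def)
      then show ?thesis by (simp add: s_def B_def)
    qed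
    then have "s n = (\<lambda>l. \<Sum>k\<in>{-N..N}. (real_of_int k / real (Suc n)) * indicator (B k) l)"
      by auto
    then show ?thesis
      using represents_step[of "{-N..N}" B "\<lambda>k. real_of_int k / real (Suc n)"] B by auto
  qed
  then obtain S where S: "\<And>n. represents (S n) (s n)" by metis
  have S_diff: "norm (S n x - S m x) \<le> (1 / real (Suc n) + 1 / real (Suc m)) * norm x" for n m x
  proof (rule represents_norm_le[OF represents_diff[OF S S s_bb s_bb]])
    show "\<bar>s n l - s m l\<bar> \<le> 1 / real (Suc n) + 1 / real (Suc m)" for l
      using s_near[of n l] s_near[of m l] by linarith
  qed measurable
  have "Cauchy (\<lambda>n. S n x)" for x
  proof (rule metric_CauchyI)
    fix e :: real assume "e > 0"
    then have "e / (2 * (norm x + 1)) > 0"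
      by (simp add: add_nonneg_pos)
    then obtain N where N: "1 / real (Suc N) < e / (2 * (norm x + 1))"
      using nat_approx_posE by (metis inverse_eq_divide)
    show "\<exists>N. \<forall>m\<ge>N. \<forall>n\<ge>N. dist (S m x) (S n x) < e"
    proof (intro exI allI impI)
      fix m n assume mn: "N \<le> m" "N \<le> n"
      have "1 / real (Suc k) \<le> 1 / real (Suc N)" if "N \<le> k" for k
        using that by (simp add: field_simps)
      from this[OF mn(1)] this[OF mn(2)]
      have "(1 / real (Suc m) + 1 / real (Suc n)) * norm x \<le> (2 * (1 / real (Suc N))) * norm x"
        by (intro mult_right_mono) auto
      also have "\<dots> \<le> 2 * (1 / real (Suc N)) * (norm x + 1)"
        by (intro mult_left_mono) auto
      also have "\<dots> < 2 * (e / (2 * (norm x + 1))) * (norm x + 1)"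
        using N by (intro mult_strict_right_mono mult_strict_left_mono) (auto simp: add_nonneg_pos)
      also have "\<dots> = e"
        using norm_ge_zero[of x] by (simp add: divide_simps add_nonneg_eq_0_iff)
      finally show "dist (S m x) (S n x) < e"
        using S_diff[of m x n] by (simp add: dist_norm)
    qed
  qed
  then have "\<exists>y. (\<lambda>n. S n x) \<longlonglongrightarrow> y" for x
    using Cauchy_convergent convergent_def by blast
  then obtain T where T: "\<And>x. (\<lambda>n. S n x) \<longlonglongrightarrow> T x" by metis
  have Slin: "linear (S n)" for n using S by (auto simp: represents_def)
  have "represents T f"
    unfolding represents_def
  proof (intro conjI allI)
    show "linear T"
    proof (rule linearI)
      fix x y a
      have "(\<lambda>n. S n (x + y)) \<longlonglongrightarrow> T x + T y"
        using tendsto_add[OF T T] by (simp add: linear_add[OF Slin])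
      then show "T (x + y) = T x + T y"
        using T LIMSEQ_unique by blast
      have "(\<lambda>n. S n (a *\<^sub>R x)) \<longlonglongrightarrow> a *\<^sub>R T x"
        using tendsto_scaleR[OF tendsto_const T] by (simp add: linear_scale[OF Slin])
      then show "T (a *\<^sub>R x) = a *\<^sub>R T x"
        using T LIMSEQ_unique by blast
    qed
    fix x y
    have "(\<lambda>n. S n x \<bullet> y) \<longlonglongrightarrow> x \<bullet> T y"
      using tendsto_inner[OF tendsto_const T, of x y] S by (simp add: represents_def)
    then show "T x \<bullet> y = x \<bullet> T y"
      using tendsto_inner[OF T tendsto_const, of x y] LIMSEQ_unique by blast
    interpret finite_measure "scalar_measure E x" by (rule finite_measure_scalar)
    have "(\<lambda>n. LINT l|scalar_measure E x. s n l) \<longlonglongrightarrow> (LINT l|scalar_measure E x. f l)"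
    proof (rule integral_dominated_convergence[where w="\<lambda>_. M + 1"])
      have "(\<lambda>n. s n l) \<longlonglongrightarrow> f l" for l
      proof (rule LIM_zero_cancel, rule Lim_null_comparison)
        show "\<forall>\<^sub>F n in sequentially. norm (s n l - f l) \<le> inverse (real (Suc n))"
          using s_near[of _ l] by (simp add: inverse_eq_divide)
      qed (rule LIMSEQ_inverse_real_of_nat)
      then show "AE l in scalar_measure E x. (\<lambda>n. s n l) \<longlonglongrightarrow> f l" by simp
    qed (use s_bound in auto)
    moreover have "S n x \<bullet> x = (LINT l|scalar_measure E x. s n l)" for n
      using S[of n] unfolding represents_def by blast
    ultimately have "(\<lambda>n. S n x \<bullet> x) \<longlonglongrightarrow> (LINT l|scalar_measure E x. f l)"
      by simp
    then show "T x \<bullet> x = (LINT l|scalar_measure E x. f l)"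
      using tendsto_inner[OF T tendsto_const, of x x] LIMSEQ_unique by blast
  qed
  then show ?thesis by blast
qed

end

section \<open>Compressions to a Borel set\<close>

context pvm
begin

definition bounded_on :: "real set \<Rightarrow> (real \<Rightarrow> real) \<Rightarrow> bool" where
  "bounded_on B f \<longleftrightarrow> B \<in> sets borel \<and> f \<in> borel_measurable borel \<and> (\<exists>M. \<forall>l\<in>B. \<bar>f l\<bar> \<le> M)"

text \<open>The operator \<open>f(A) E(B)\<close> of the functional calculus, bounded as soon as
  \<open>f\<close> is bounded on \<open>B\<close>, even if \<open>f\<close> is unbounded on the
  line.\<close>

definition compression :: "real set \<Rightarrow> (real \<Rightarrow> real) \<Rightarrow> 'h \<Rightarrow> 'h" where
  "compression B f = (SOME T. represents T (\<lambda>l. indicator B l * f l))"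

lemma bounded_borel_indicator:
  assumes "bounded_on B f"
  shows "bounded_borel (\<lambda>l. indicator B l * f l)"
proof -
  obtain M where M: "\<forall>l\<in>B. \<bar>f l\<bar> \<le> M" and [measurable]: "B \<in> sets borel" "f \<in> borel_measurable borel"
    using assms by (auto simp: bounded_on_def)
  have "\<bar>indicator B l * f l\<bar> \<le> \<bar>M\<bar>" for l
    using M by (auto simp: indicator_def intro: order_trans)
  moreover have "(\<lambda>l. indicator B l * f l) \<in> borel_measurable borel"
    by measurable
  ultimately show ?thesis
    unfolding bounded_borel_def by blast
qed

lemma represents_compression:
  assumes "bounded_on B f"
  shows "represents (compression B f) (\<lambda>l. indicator B l * f l)"
  unfolding compression_def
  using represents_exists[OF bounded_borel_indicator[OF assms]] by (rule someI_ex)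

lemma
  assumes "bounded_on B f"
  shows linear_compression: "linear (compression B f)"
    and compression_sym: "compression B f x \<bullet> y = x \<bullet> compression B f y"
    and compression_inner_self:
      "compression B f x \<bullet> x = (LINT l|scalar_measure E x. indicator B l * f l)"
  using represents_compression[OF assms] by (auto simp: represents_def)

lemma norm_compression_le:
  assumes "bounded_on B f" and "M \<ge> 0" and "\<And>l. l \<in> B \<Longrightarrow> \<bar>f l\<bar> \<le> M"
  shows "norm (compression B f x) \<le> M * norm x"
  by (rule represents_norm_le[OF represents_compression[OF assms(1)]])
     (use assms bounded_borel_indicator[OF assms(1)] in \<open>auto simp: indicator_def bounded_borel_def\<close>)

lemma bounded_linear_compression:
  assumes "bounded_on B f"
  shows "bounded_linear (compression B f)"
proof -
  obtain M where M: "\<forall>l\<in>B. \<bar>f l\<bar> \<le> M"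
    using assms by (auto simp: bounded_on_def)
  interpret linear "compression B f" by (rule linear_compression[OF assms])
  have "norm (compression B f x) \<le> norm x * \<bar>M\<bar>" for x
    using norm_compression_le[OF assms, of "\<bar>M\<bar>" x] M by (force simp: mult.commute)
  then show ?thesis
    by (intro bounded_linear_intro[where K="\<bar>M\<bar>"]) (simp_all add: add scale)
qed

text \<open>The remainder \<open>y = x - E B x\<close> has no component in \<open>B\<close>, so
  \<open>w + y\<close> and \<open>w - y\<close> give the same quadratic form. Polarization makes
  \<open>compression B f w\<close> orthogonal to \<open>y\<close> for every \<open>w\<close>, and
  symmetry yields \<open>compression B f y = 0\<close>.\<close>

lemma compression_proj:
  assumes "bounded_on B f"
  shows "compression B f (E B x) = compression B f x"
proof -
  have B: "B \<in> sets borel" and f: "f \<in> borel_measurable borel"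
    using assms by (auto simp: bounded_on_def)
  interpret P: linear "E B" by (rule linear_proj[OF B])
  interpret C: linear "compression B f" by (rule linear_compression[OF assms])
  define y where "y = x - E B x"
  have y: "E B y = 0"
    by (simp add: y_def P.diff proj_idem[OF B])
  have "compression B f y \<bullet> w = 0" for w
  proof -
    have "E B (w + y) = E B (w - y)"
      by (simp add: P.add P.diff y)
    from scalar_restrict_eq(2)[OF B this f]
    have "compression B f (w + y) \<bullet> (w + y) = compression B f (w - y) \<bullet> (w - y)"
      by (simp add: compression_inner_self[OF assms])
    then have "compression B f w \<bullet> y = 0"
      using symmetric_polarization[OF C.linear_axioms compression_sym[OF assms], of w y] by simp
    then show ?thesis
      by (metis compression_sym[OF assms] inner_commute)
  qed
  from this[of "compression B f y"] have "compression B f y = 0"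
    by simp
  then show ?thesis
    by (simp add: y_def C.diff)
qed

text \<open>The adjoint of \<open>compression_proj\<close>, as both operators are symmetric.\<close>

lemma proj_compression:
  assumes "bounded_on B f"
  shows "E B (compression B f x) = compression B f x"
proof -
  have B: "B \<in> sets borel"
    using assms by (auto simp: bounded_on_def)
  have "(E B (compression B f x) - compression B f x) \<bullet> w = 0" for w
    using compression_proj[OF assms, of w]
    by (simp add: inner_diff proj_sym[OF B] compression_sym[OF assms])
  from this[of "E B (compression B f x) - compression B f x"] show ?thesis
    by simp
qed

text \<open>The scalar measure of such an \<open>x\<close> gives \<open>B\<close> the full mass
  \<open>(norm x)\<^sup>2\<close>, so the pointwise bound \<open>m \<le> f\<close> on
  \<open>B\<close> integrates to the claim.\<close>

lemma compression_inner_ge: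
  assumes "bounded_on B f" and m: "\<And>l. l \<in> B \<Longrightarrow> m \<le> f l" and x: "E B x = x"
  shows "m * (norm x)\<^sup>2 \<le> compression B f x \<bullet> x"
proof -
  have B: "B \<in> sets borel"
    using assms(1) by (simp add: bounded_on_def)
  interpret finite_measure "scalar_measure E x" by (rule finite_measure_scalar)
  have "m * (norm x)\<^sup>2 = (LINT l|scalar_measure E x. m * indicator B l)"
    using x B by (simp add: measure_scalar)
  also have "\<dots> \<le> (LINT l|scalar_measure E x. indicator B l * f l)"
  proof (rule integral_mono)
    show "integrable (scalar_measure E x) (\<lambda>l. m * indicator B l)"
      using B by (auto intro!: integrable_mult_right integrable_real_indicator simp: less_top[symmetric])
    show "integrable (scalar_measure E x) (\<lambda>l. indicator B l * f l)"
      by (intro bounded_borel_integrable bounded_borel_indicator assms(1))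
  qed (use m in \<open>auto simp: indicator_def\<close>)
  finally show ?thesis
    by (simp add: compression_inner_self[OF assms(1)])
qed

section \<open>Spectral integrals of unbounded functions\<close>

lemma scalar_measure_uminus: "scalar_measure E (- w) = scalar_measure E w"
proof (rule measure_eqI)
  fix C assume "C \<in> sets (scalar_measure E (- w))"
  then have C: "C \<in> sets borel" by simp
  then show "emeasure (scalar_measure E (- w)) C = emeasure (scalar_measure E w) C"
    by (simp add: emeasure_scalar linear_neg[OF linear_proj])
qed simp

lemma spectral_domain_uminus: "w \<in> spectral_domain E f \<Longrightarrow> - w \<in> spectral_domain E f"
  by (simp add: spectral_domain_def scalar_measure_uminus)

lemma proj_uminus_set:
  assumes "B \<in> sets borel"
  shows "E (- B) (E B x) = 0"
  using assms by (simp add: proj_Int)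

lemma integral_scalar_split:
  fixes f :: "real \<Rightarrow> real"
  assumes B: "B \<in> sets borel" and i: "integrable (scalar_measure E x) f"
  shows "(LINT l|scalar_measure E x. f l) = (LINT l|scalar_measure E x. indicator B l * f l) +
    (LINT l|scalar_measure E x. indicator (- B) l * f l)"
proof -
  have *: "integrable (scalar_measure E x) (\<lambda>l. indicator C l * f l)" if "C \<in> sets borel" for C
    using integrable_mult_indicator[OF _ i, of C] that by simp
  have "(LINT l|scalar_measure E x. f l) =
      (LINT l|scalar_measure E x. indicator B l * f l + indicator (- B) l * f l)"
    by (rule Bochner_Integration.integral_cong) (auto simp: indicator_def)
  also have "\<dots> = (LINT l|scalar_measure E x. indicator B l * f l) +
    (LINT l|scalar_measure E x. indicator (- B) l * f l)"
    using B by (intro Bochner_Integration.integral_add * ) auto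
  finally show ?thesis .
qed

lemma spectral_domain_integrable:
  assumes f: "f \<in> borel_measurable borel" and "x \<in> spectral_domain E f"
  shows "integrable (scalar_measure E x) f"
proof -
  interpret finite_measure "scalar_measure E x" by (rule finite_measure_scalar)
  have "integrable (scalar_measure E x) (\<lambda>l. 1 + (f l)\<^sup>2)"
    using assms by (intro Bochner_Integration.integrable_add) (auto simp: spectral_domain_def)
  then show ?thesis
  proof (rule Bochner_Integration.integrable_bound)
    have "\<bar>f l\<bar> \<le> 1 + (f l)\<^sup>2" for l
      using sum_squares_ge_zero[of "\<bar>f l\<bar> - 1/2" 0] by (simp add: power2_eq_square algebra_simps)
    then show "AE l in scalar_measure E x. norm (f l) \<le> norm (1 + (f l)\<^sup>2)"
      by (auto intro: order_trans)
  qed (use f in simp)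
qed

text \<open>Split the integral of \<open>f\<^sup>2\<close> at \<open>B\<close>: on \<open>B\<close>
  the function is bounded, and off \<open>B\<close> the vectors \<open>x + w\<close> and
  \<open>w\<close> have the same scalar measure.\<close>

lemma spectral_domain_shift:
  assumes bd: "bounded_on B f" and w: "w \<in> spectral_domain E f" and x: "E B x = x"
  shows "x + w \<in> spectral_domain E f"
proof -
  have B: "B \<in> sets borel" and f [measurable]: "f \<in> borel_measurable borel"
    using bd by (auto simp: bounded_on_def)
  obtain M where M: "\<forall>l\<in>B. \<bar>f l\<bar> \<le> M" using bd by (auto simp: bounded_on_def)
  have "bounded_on B (\<lambda>l. (f l)\<^sup>2)"
    unfolding bounded_on_def using B M f
    by (intro conjI exI[of _ "M\<^sup>2"]) (auto simp: abs_le_square_iff intro!: power2_le_iff_abs_le[THEN iffD2] intro: order_trans)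
  then have 1: "integrable (scalar_measure E (x + w)) (\<lambda>l. indicator B l * (f l)\<^sup>2)"
    by (intro bounded_borel_integrable bounded_borel_indicator)
  have "E (- B) (x + w) = E (- B) w"
    using proj_uminus_set[OF B, of x] B x by (simp add: linear_add[OF linear_proj])
  moreover have "integrable (scalar_measure E w) (\<lambda>l. indicator (- B) l * (f l)\<^sup>2)"
    using integrable_mult_indicator[of "- B" "scalar_measure E w" "\<lambda>l. (f l)\<^sup>2"] B w
    by (simp add: spectral_domain_def)
  ultimately have 2: "integrable (scalar_measure E (x + w)) (\<lambda>l. indicator (- B) l * (f l)\<^sup>2)"
    using B by (subst scalar_restrict_eq(1)[where y=w]) auto
  have "(\<lambda>l. (f l)\<^sup>2) = (\<lambda>l. indicator B l * (f l)\<^sup>2 + indicator (- B) l * (f l)\<^sup>2)"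
    by (auto simp: indicator_def)
  then show ?thesis
    using Bochner_Integration.integrable_add[OF 1 2] by (simp add: spectral_domain_def)
qed

lemma spectral_domain_0:
  assumes "f \<in> borel_measurable borel"
  shows "0 \<in> spectral_domain E f"
proof -
  interpret finite_measure "scalar_measure E 0" by (rule finite_measure_scalar)
  have "UNIV \<in> null_sets (scalar_measure E 0)"
    by (auto simp: null_sets_def emeasure_scalar)
  then have "AE l in scalar_measure E 0. norm ((f l)\<^sup>2) \<le> 0"
    by (rule AE_I') simp
  then show ?thesis
    using assms unfolding spectral_domain_def mem_Collect_eq
    by (intro integrable_const_bound) auto
qed

lemma proj_in_spectral_domain:
  assumes "bounded_on B f"
  shows "E B x \<in> spectral_domain E f"
  using spectral_domain_shift[OF assms spectral_domain_0, of "E B x"] assms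
  by (simp add: proj_idem bounded_on_def)

text \<open>In the polarized formula the parts off \<open>B\<close> cancel: for \<open>x + w\<close>
  and for \<open>x - w\<close> they are those of \<open>w\<close> and \<open>- w\<close>, which have
  equal scalar measures. What remains on \<open>B\<close> is the polarization of the
  compression.\<close>

lemma spectral_integral_proj:
  assumes bd: "bounded_on B f" and x: "E B x = x"
  shows "(x, compression B f x) \<in> spectral_integral E f"
proof -
  have B: "B \<in> sets borel" and f: "f \<in> borel_measurable borel"
    using bd by (auto simp: bounded_on_def)
  interpret P: linear "E (- B)" using B by (intro linear_proj) auto
  have x0: "E (- B) x = 0" using proj_uminus_set[OF B, of x] x by simp
  have "compression B f x \<bullet> w =
      ((LINT l|scalar_measure E (x + w). f l) - (LINT l|scalar_measure E (x - w). f l)) / 4"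
    if w: "w \<in> spectral_domain E f" for w
  proof -
    have plus: "x + w \<in> spectral_domain E f"
      by (rule spectral_domain_shift[OF bd w x])
    have minus: "x - w \<in> spectral_domain E f"
      using spectral_domain_shift[OF bd spectral_domain_uminus[OF w] x] by simp
    have "(LINT l|scalar_measure E (x + w). indicator (- B) l * f l) =
        (LINT l|scalar_measure E w. indicator (- B) l * f l)"
      using B f by (intro scalar_restrict_eq(2)) (auto simp: P.add x0)
    moreover have "(LINT l|scalar_measure E (x - w). indicator (- B) l * f l) =
        (LINT l|scalar_measure E (- w). indicator (- B) l * f l)"
      using B f by (intro scalar_restrict_eq(2)) (auto simp: P.diff P.neg x0)
    ultimately have "(LINT l|scalar_measure E (x + w). f l) - (LINT l|scalar_measure E (x - w). f l) =
        compression B f (x + w) \<bullet> (x + w) - compression B f (x - w) \<bullet> (x - w)"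
      using integral_scalar_split[OF B spectral_domain_integrable[OF f plus]]
        integral_scalar_split[OF B spectral_domain_integrable[OF f minus]]
      by (simp add: scalar_measure_uminus compression_inner_self[OF bd])
    then show ?thesis
      using symmetric_polarization[OF linear_compression[OF bd] compression_sym[OF bd], of x w] by simp
  qed
  then show ?thesis
    using proj_in_spectral_domain[OF bd, of x] x by (auto simp: spectral_integral_def)
qed

text \<open>Density of the domain is replaced by explicit test vectors:
  \<open>E (B n) (y - y')\<close> lies in the domain, which forces it to vanish, and the sets
  \<open>B n\<close> where \<open>f\<close> is bounded by \<open>n\<close> exhaust the line.\<close>

lemma spectral_integral_unique:
  assumes f: "f \<in> borel_measurable borel"
    and "(x, y) \<in> spectral_integral E f" "(x, y') \<in> spectral_integral E f"
  shows "y = y'"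
proof -
  define B where "B n = {l. \<bar>f l\<bar> \<le> real n}" for n
  have B: "B n \<in> sets borel" for n
    unfolding B_def using f by measurable
  have bd: "bounded_on (B n) f" for n
    unfolding bounded_on_def using f B by (auto simp: B_def)
  have "E (B n) (y - y') = 0" for n
  proof -
    have "E (B n) (y - y') \<in> spectral_domain E f"
      by (rule proj_in_spectral_domain[OF bd])
    then have "y \<bullet> E (B n) (y - y') = y' \<bullet> E (B n) (y - y')"
      using assms(2,3) unfolding spectral_integral_def mem_Collect_eq prod.case by metis
    then have "(y - y') \<bullet> E (B n) (y - y') = 0"
      by (simp add: inner_diff_left)
    then show ?thesis
      using proj_inner_self[OF B, of n "y - y'"] by (simp add: inner_commute)
  qed
  moreover have "(\<lambda>n. E (B n) (y - y')) \<longlonglongrightarrow> y - y'"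
  proof (rule proj_tendsto[OF B])
    show "incseq B" by (auto simp: B_def incseq_def)
    show "(\<Union>n. B n) = UNIV"
      using real_arch_simple by (auto simp: B_def)
  qed
  ultimately show ?thesis
    using LIMSEQ_unique[OF tendsto_const] by fastforce
qed

end

section \<open>A positive self-adjoint operator with a spectral measure\<close>

lemma app_eq:
  assumes "\<And>y'. (x, y') \<in> A \<Longrightarrow> y' = y" "(x, y) \<in> A"
  shows "app A x = y"
  unfolding app_def using assms by blast

locale positive_spectral = pvm E
  for E :: "real set \<Rightarrow> 'h::{real_inner, complete_space} \<Rightarrow> 'h" +
  fixes A :: "'h operator"
  assumes self_adjoint: "self_adjoint A"
    and positive: "positive_operator A"
    and spectral: "A = spectral_integral E (\<lambda>l. l)"
begin

lemma operator_unique: "(x, y) \<in> A \<Longrightarrow> (x, z) \<in> A \<Longrightarrow> y = z"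
  using self_adjoint by (auto simp: self_adjoint_def linear_operator_def dest: single_valuedD)

lemma app_operator: "(x, y) \<in> A \<Longrightarrow> app A x = y"
  by (rule app_eq) (auto intro: operator_unique)

lemma operator_sym: "(x, y) \<in> A \<Longrightarrow> (w, z) \<in> A \<Longrightarrow> y \<bullet> w = x \<bullet> z"
  using self_adjoint unfolding self_adjoint_def adjoint_operator_def by fast

text \<open>Membership in the adjoint is a family of equations continuous in \<open>(x, y)\<close>,
  and \<open>A\<close> equals its adjoint.\<close>

lemma operator_closed:
  assumes "\<And>n. (X n, Y n) \<in> A" "X \<longlonglongrightarrow> x" "Y \<longlonglongrightarrow> y"
  shows "(x, y) \<in> A"
proof -
  have "z \<bullet> x = w \<bullet> y" if "(w, z) \<in> A" for w z
  proof (rule LIMSEQ_unique)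
    show "(\<lambda>n. z \<bullet> X n) \<longlonglongrightarrow> z \<bullet> x" by (intro tendsto_intros assms)
    have "z \<bullet> X n = w \<bullet> Y n" for n
      using operator_sym[OF that assms(1)] .
    then show "(\<lambda>n. z \<bullet> X n) \<longlonglongrightarrow> w \<bullet> y"
      by (simp add: tendsto_intros assms)
  qed
  then have "(x, y) \<in> adjoint_operator A"
    by (auto simp: adjoint_operator_def)
  then show ?thesis
    using self_adjoint by (simp add: self_adjoint_def)
qed

definition bdd :: "real set \<Rightarrow> bool" where
  "bdd B \<longleftrightarrow> B \<in> sets borel \<and> bounded B"

lemma bounded_on_id: "bdd B \<Longrightarrow> bounded_on B (\<lambda>l. l)"
  by (auto simp: bdd_def bounded_on_def bounded_iff)

lemma operator_proj:
  assumes "bdd B" "E B x = x"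
  shows "(x, compression B (\<lambda>l. l) x) \<in> A"
  using spectral_integral_proj[OF bounded_on_id[OF assms(1)] assms(2)] by (simp add: spectral)

lemma app_proj:
  assumes "bdd B" "E B x = x"
  shows "app A x = compression B (\<lambda>l. l) x"
  by (rule app_operator[OF operator_proj[OF assms]])

text \<open>On a window to the left of \<open>0\<close> the form of \<open>A\<close> is at most a
  negative multiple of \<open>(norm z)\<^sup>2\<close>, while positivity makes it nonnegative; hence
  the window carries no vector. Countably many windows cover the negative half-line.\<close>

lemma proj_negative: "E {..<0} x = 0"
proof -
  interpret finite_measure "scalar_measure E x" by (rule finite_measure_scalar)
  \<comment> \<open>Bounded, so that its vectors lie in \<open>Domain A\<close>, and at distance
    \<open>1 / Suc n\<close> from \<open>0\<close>, so that the form is strictly negative.\<close>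
  define B where "B n = {- real (Suc n) .. - (1 / real (Suc n))}" for n :: nat
  have B: "bdd (B n)" for n by (simp add: B_def bdd_def)
  have "E (B n) x = 0" for n
  proof -
    define z where "z = E (B n) x"
    have z: "E (B n) z = z"
      using B[of n] by (simp add: z_def bdd_def proj_idem)
    have zA: "(z, compression (B n) (\<lambda>l. l) z) \<in> A"
      by (rule operator_proj[OF B z])
    interpret C: linear "compression (B n) (\<lambda>l. l)"
      by (rule linear_compression[OF bounded_on_id[OF B]])
    have bd: "bounded_on (B n) (\<lambda>l. - l)"
      using bounded_on_id[OF B, of n] by (auto simp: bounded_on_def)
    have "(1 / real (Suc n)) * (norm z)\<^sup>2 \<le> compression (B n) (\<lambda>l. - l) z \<bullet> z"
      by (rule compression_inner_ge[OF bd _ z]) (simp add: B_def)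
    also have "\<dots> = - (compression (B n) (\<lambda>l. l) z \<bullet> z)"
      by (simp add: compression_inner_self[OF bd] compression_inner_self[OF bounded_on_id[OF B]])
    also have "\<dots> \<le> 0"
    proof -
      have "app A z \<bullet> z \<ge> 0"
        using positive zA unfolding positive_operator_def by blast
      then show ?thesis
        by (simp add: app_operator[OF zA])
    qed
    finally have "(norm z)\<^sup>2 \<le> 0"
      by (simp add: mult_le_0_iff divide_le_0_iff)
    then show ?thesis by (simp add: z_def)
  qed
  then have "B n \<in> null_sets (scalar_measure E x)" for n
    using B[of n] by (auto simp: null_sets_def emeasure_scalar bdd_def)
  then have "(\<Union>n. B n) \<in> null_sets (scalar_measure E x)"
    by (rule null_sets_UN)
  moreover have "{..<0::real} \<subseteq> (\<Union>n. B n)"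
  proof
    fix l :: real assume "l \<in> {..<0}"
    then have l: "l < 0" by simp
    obtain n where n: "max (- l) (1 / (- l)) \<le> real n"
      using real_arch_simple by blast
    then have "- l \<le> real (Suc n)" "1 / (- l) \<le> real (Suc n)" by auto
    then have "l \<in> B n"
      using l by (simp add: B_def field_simps)
    then show "l \<in> (\<Union>n. B n)" by blast
  qed
  ultimately have "{..<0} \<in> null_sets (scalar_measure E x)"
    using null_sets_subset[of _ "scalar_measure E x" "{..<0}"] by auto
  then show ?thesis
    by (auto simp: null_sets_def emeasure_scalar)
qed

lemma proj_nonneg: "E {0..} x = x"
proof -
  have "(norm (x - E {0..} x))\<^sup>2 = measure (scalar_measure E x) {..<0}"
    by (subst norm_diff_proj) (auto simp: Compl_atLeast)
  also have "\<dots> = 0" by (simp add: measure_scalar proj_negative)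
  finally show ?thesis by simp
qed

end

section \<open>Uniqueness of the spectral measure\<close>

locale two_spectral = E: positive_spectral E A + E': positive_spectral E' A
  for E E' :: "real set \<Rightarrow> 'h::{real_inner, complete_space} \<Rightarrow> 'h" and A :: "'h operator"
begin

text \<open>
  The projection \<open>P = E' [b', M]\<close> intertwines the restrictions of \<open>A\<close> to the two ranges. It maps a
  space on which \<open>A\<close> is bounded by \<open>b\<close> into one on which \<open>A\<close> is at least \<open>b' > b\<close>, which forces
  \<open>|P z| \<le> (b / b')\<^sup>n |z|\<close> for all \<open>n\<close>.
\<close>

lemma proj_gap:
  assumes b: "0 \<le> b" "b < b'" and x: "E {0..b} x = x"
  shows "E' {b'..M} x = 0"
proof -
  have B: "E.bdd {0..b}" and C: "E'.bdd {b'..M}"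
    by (simp_all add: E.bdd_def E'.bdd_def)
  define S where "S = E.compression {0..b} (\<lambda>l. l)"
  define S' where "S' = E'.compression {b'..M} (\<lambda>l. l)"
  define P where "P = E' {b'..M}"
  note Bf = E.bounded_on_id[OF B] and Cf = E'.bounded_on_id[OF C]
  have PP: "P (P z) = P z" for z
    by (simp add: P_def E'.proj_idem)
  have comm: "S' (P z) = P (S z)" if z: "E {0..b} z = z" for z
  proof -
    have "S' (P z) \<bullet> w = P (S z) \<bullet> w" for w
    proof -
      have "P (S z) \<bullet> w = S z \<bullet> P w"
        by (simp add: P_def E'.proj_sym)
      \<comment> \<open>\<open>S\<close> is \<open>A\<close> on the range of \<open>E {0..b}\<close>
        and \<open>S'\<close> is \<open>A\<close> on the range of \<open>P\<close>, so symmetry of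
        \<open>A\<close> transfers one to the other.\<close>
      also have "\<dots> = z \<bullet> S' (P w)"
        using E.operator_sym[OF E.operator_proj[OF B z] E'.operator_proj[OF C, of "P w"]] PP[of w]
        by (simp add: S_def S'_def P_def)
      also have "\<dots> = z \<bullet> S' w"
        unfolding S'_def P_def by (simp only: E'.compression_proj[OF Cf])
      also have "\<dots> = S' z \<bullet> w"
        unfolding S'_def by (rule E'.compression_sym[OF Cf, symmetric])
      also have "\<dots> = S' (P z) \<bullet> w"
        unfolding S'_def P_def by (simp only: E'.compression_proj[OF Cf])
      finally show ?thesis ..
    qed
    from this[of "S' (P z) - P (S z)"] have "(norm (S' (P z) - P (S z)))\<^sup>2 = 0"
      by (simp add: power2_norm_eq_inner inner_diff_left)
    then show ?thesis by simp
  qed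
  have lower: "b' * norm (P z) \<le> norm (S' (P z))" for z
  proof (cases "P z = 0")
    case False
    have "b' * (norm (P z))\<^sup>2 \<le> S' (P z) \<bullet> P z"
      unfolding S'_def by (rule E'.compression_inner_ge[OF Cf]) (use PP in \<open>simp_all add: P_def\<close>)
    also have "\<dots> \<le> norm (S' (P z)) * norm (P z)"
      by (rule norm_cauchy_schwarz)
    finally have "(b' * norm (P z)) * norm (P z) \<le> norm (S' (P z)) * norm (P z)"
      by (simp add: power2_eq_square mult.assoc)
    then show ?thesis using False by simp
  qed simp
  have upper: "norm (S z) \<le> b * norm z" for z
    unfolding S_def by (rule E.norm_compression_le[OF Bf]) (use b in auto)
  have decay: "norm (P z) \<le> (b / b') ^ n * norm z" if "E {0..b} z = z" for z n
    using that
  proof (induction n arbitrary: z)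
    case 0
    then show ?case by (simp add: P_def E'.norm_proj_le)
  next
    case (Suc n)
    have Sz: "E {0..b} (S z) = S z"
      unfolding S_def by (rule E.proj_compression[OF Bf])
    have "b' * norm (P z) \<le> norm (P (S z))"
      using lower[of z] comm[OF Suc.prems] by simp
    also have "\<dots> \<le> (b / b') ^ n * norm (S z)"
      by (rule Suc.IH[OF Sz])
    also have "\<dots> \<le> (b / b') ^ n * (b * norm z)"
      using b by (intro mult_left_mono upper) auto
    finally show ?case
      using b by (simp add: field_simps)
  qed
  have "(\<lambda>n. (b / b') ^ n * norm x) \<longlonglongrightarrow> 0 * norm x"
    using b by (intro tendsto_mult tendsto_const LIMSEQ_realpow_zero) auto
  then have "norm (P x) \<le> 0 * norm x"
    by (rule LIMSEQ_le_const) (use decay[OF x] in auto)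
  then show ?thesis by (simp add: P_def)
qed

text \<open>The range of \<open>E {..b}\<close> is contained in that of \<open>E' {..b}\<close>. By
  positivity a vector \<open>z\<close> of the first range lies in \<open>E {0..b}\<close>, so
  \<open>proj_gap\<close> makes its \<open>E'\<close>-measure vanish above \<open>b\<close>.\<close>

lemma proj_atMost_le:
  assumes b: "0 \<le> b"
  shows "E' {..b} (E {..b} x) = E {..b} x"
proof -
  define z where "z = E {..b} x"
  have "E {..b} x = E {..b} (E {0..} x)"
    by (simp add: E.proj_nonneg)
  also have "\<dots> = E {0..b} x"
    by (subst E.proj_Int) (auto intro!: arg_cong[where f="\<lambda>B. E B x"])
  finally have z: "E {0..b} z = z"
    by (simp add: z_def E.proj_idem)
  \<comment> \<open>\<open>proj_gap\<close> needs a strict gap above \<open>b\<close> and a finite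
    upper end; both are relaxed as \<open>n\<close> grows, so that the union covers
    \<open>{b<..}\<close>.\<close>
  define C where "C n = {b + 1 / real (Suc n)..real n}" for n
  have "E' (C n) z = 0" for n
    unfolding C_def by (rule proj_gap[OF b _ z]) simp
  then have "C n \<in> null_sets (scalar_measure E' z)" for n
    by (auto simp: null_sets_def E'.emeasure_scalar C_def)
  then have "(\<Union>n. C n) \<in> null_sets (scalar_measure E' z)"
    by (rule null_sets_UN)
  moreover have "{b<..} \<subseteq> (\<Union>n. C n)"
  proof
    fix l assume "l \<in> {b<..}"
    then have l: "b < l" by simp
    obtain n where n: "max l (1 / (l - b)) \<le> real n"
      using real_arch_simple by blast
    then have "l \<le> real n" "1 / (l - b) \<le> real (Suc n)" by auto
    then have "l \<in> C n"
      using l by (simp add: C_def field_simps)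
    then show "l \<in> (\<Union>n. C n)" by blast
  qed
  ultimately have "{b<..} \<in> null_sets (scalar_measure E' z)"
    using null_sets_subset[of _ "scalar_measure E' z" "{b<..}"] by auto
  then have "(norm (z - E' {..b} z))\<^sup>2 = 0"
    by (subst E'.norm_diff_proj) (auto simp: Compl_atMost null_sets_def measure_def)
  then show ?thesis by (simp add: z_def)
qed

lemma proj_atMost_negative:
  assumes "b < 0"
  shows "E {..b} x = 0"
proof -
  have "E {..b} x = E {..b} (E {..<0} x)"
    using assms by (subst E.proj_Int) (auto intro!: arg_cong[where f="\<lambda>B. E B x"])
  then show ?thesis
    by (simp add: E.proj_negative linear_0[OF E.linear_proj])
qed

end

text \<open>Range inclusion in both directions makes the orthogonal projections
  \<open>E {..b}\<close> and \<open>E' {..b}\<close> equal, and a finite measure is determined by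
  its values on half-lines. Scalar measures suffice because \<open>spectral_integral\<close> sees
  \<open>E\<close> only through them.\<close>

lemma scalar_measure_unique:
  assumes "positive_spectral E A" "positive_spectral E' A"
  shows "scalar_measure E x = scalar_measure E' x"
proof -
  interpret E: positive_spectral E A by fact
  interpret E': positive_spectral E' A by fact
  interpret EE': two_spectral E E' A ..
  interpret E'E: two_spectral E' E A ..
  have eq: "E {..b} x = E' {..b} x" for b x
  proof (cases "b < 0")
    case True
    then show ?thesis
      by (simp add: EE'.proj_atMost_negative E'E.proj_atMost_negative)
  next
    case False
    then have b: "0 \<le> b" by simp
    have "E {..b} x \<bullet> y = E' {..b} x \<bullet> y" for y
    proof -
      have "E {..b} x \<bullet> y = x \<bullet> E' {..b} (E {..b} y)"
        by (simp add: E.proj_sym EE'.proj_atMost_le[OF b])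
      also have "\<dots> = E {..b} (E' {..b} x) \<bullet> y"
        by (simp add: E.proj_sym E'.proj_sym)
      also have "\<dots> = E' {..b} x \<bullet> y"
        by (simp add: E'E.proj_atMost_le[OF b])
      finally show ?thesis .
    qed
    from this[of "E {..b} x - E' {..b} x"] have "(norm (E {..b} x - E' {..b} x))\<^sup>2 = 0"
      by (simp add: power2_norm_eq_inner inner_diff_left)
    then show ?thesis by simp
  qed
  interpret M: finite_measure "scalar_measure E x" by (rule E.finite_measure_scalar)
  interpret M': finite_measure "scalar_measure E' x" by (rule E'.finite_measure_scalar)
  show ?thesis
  proof (rule measure_eqI_lessThan)
    fix b :: real
    show "emeasure (scalar_measure E x) {b<..} < \<infinity>"
      by (simp add: less_top[symmetric])
    have "measure (scalar_measure E x) {b<..} = measure (scalar_measure E' x) {b<..}"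
      using E.norm_diff_proj[of "{..b}" x] E'.norm_diff_proj[of "{..b}" x] eq[of b x]
      by (simp add: Compl_atMost)
    then show "emeasure (scalar_measure E x) {b<..} = emeasure (scalar_measure E' x) {b<..}"
      by (simp add: M.emeasure_eq_measure M'.emeasure_eq_measure)
  qed simp_all
qed

section \<open>Fractional powers through the fixed spectral measure\<close>

context positive_spectral
begin

lemma frac_power_eq: "frac_power A a = spectral_integral E (\<lambda>l. l powr a)"
proof -
  have E: "is_spectral_measure_of E A"
    using pvm spectral by (simp add: is_spectral_measure_of_def)
  have "spectral_integral E' f = spectral_integral E f" if "is_spectral_measure_of E' A" for E' f
  proof -
    have "positive_spectral E' A"
      using that self_adjoint positive
      by unfold_locales (auto simp: is_spectral_measure_of_def)
    from scalar_measure_unique[OF this positive_spectral_axioms]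
    have "scalar_measure E' = scalar_measure E" by auto
    then show ?thesis
      by (simp add: spectral_integral_def spectral_domain_def)
  qed
  then show ?thesis
    unfolding frac_power_def using E by blast
qed

text \<open>Evaluates the damping term on test vectors from a window: on a bounded nonnegative set
  \<open>l powr a\<close> is bounded, so the unbounded power acts there as a compression.\<close>

lemma app_frac_power_proj:
  assumes bd: "bdd B" and B0: "B \<subseteq> {0..}" and x: "E B x = x" and a: "a \<ge> 0"
  shows "bounded_on B (\<lambda>l. l powr a)"
    and "app (frac_power A a) x = compression B (\<lambda>l. l powr a) x"
proof -
  obtain M where M: "\<And>l. l \<in> B \<Longrightarrow> \<bar>l\<bar> \<le> M"
    using bd by (auto simp: bdd_def bounded_iff)
  have "\<bar>l powr a\<bar> \<le> M powr a" if "l \<in> B" for l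
    using M[OF that] B0 that a by (auto intro!: powr_mono2)
  then show bf: "bounded_on B (\<lambda>l. l powr a)"
    using bd by (auto simp: bounded_on_def bdd_def)
  show "app (frac_power A a) x = compression B (\<lambda>l. l powr a) x"
    unfolding frac_power_eq
  proof (rule app_eq)
    show "(x, compression B (\<lambda>l. l powr a) x) \<in> spectral_integral E (\<lambda>l. l powr a)"
      by (rule spectral_integral_proj[OF bf x])
    then show "y = compression B (\<lambda>l. l powr a) x"
      if "(x, y) \<in> spectral_integral E (\<lambda>l. l powr a)" for y
      using that by (intro spectral_integral_unique[of "\<lambda>l. l powr a"]) auto
  qed
qed

end

section \<open>Decay of a spectral window of the solution\<close>

text \<open>The mean value inequality bounds the first-order remainder tested against any
  \<open>w\<close>. The bound is proportional to \<open>norm w\<close>, so testing against the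
  remainder itself bounds its norm. Continuity of \<open>G\<close> supplies the small factor
  \<open>e\<close>.\<close>

lemma has_vector_derivative_of_weak:
  fixes p G :: "real \<Rightarrow> 'h::real_inner"
  assumes weak: "\<And>w t. t \<ge> 0 \<Longrightarrow> ((\<lambda>s. p s \<bullet> w) has_real_derivative G t \<bullet> w) (at t within {0..})"
    and G: "continuous_on {0..} G" and t: "t \<ge> 0"
  shows "(p has_vector_derivative G t) (at t within {0..})"
  unfolding has_vector_derivative_def has_derivative_within_alt
proof (intro conjI allI impI)
  show "bounded_linear (\<lambda>h. h *\<^sub>R G t)"
    by (rule bounded_linear_scaleR_left)
  fix e :: real assume "e > 0"
  then obtain d where d: "d > 0" "\<And>s. s \<ge> 0 \<Longrightarrow> dist s t < d \<Longrightarrow> dist (G s) (G t) < e"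
    using G t unfolding continuous_on_iff by (metis atLeast_iff)
  show "\<exists>d>0. \<forall>y\<in>{0..}. norm (y - t) < d \<longrightarrow>
      norm (p y - p t - (y - t) *\<^sub>R G t) \<le> e * norm (y - t)"
  proof (intro exI[of _ d] conjI ballI impI d(1))
    fix y :: real assume y: "y \<in> {0..}" "norm (y - t) < d"
    define w where "w = p y - p t - (y - t) *\<^sub>R G t"
    \<comment> \<open>A convex neighbourhood of \<open>t\<close> in the half-line on which
      \<open>G\<close> stays within \<open>e\<close> of \<open>G t\<close>.\<close>
    define S where "S = {0..} \<inter> ball t d"
    have "norm ((p y \<bullet> w - y * (G t \<bullet> w)) - (p t \<bullet> w - t * (G t \<bullet> w))) \<le> (e * norm w) * norm (y - t)"
    proof (rule field_differentiable_bound[of S])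
      show "convex S" by (simp add: S_def convex_Int)
      fix s assume s: "s \<in> S"
      then have s0: "s \<ge> 0" by (simp add: S_def)
      have "((\<lambda>s. p s \<bullet> w) has_real_derivative G s \<bullet> w) (at s within S)"
        using weak[OF s0, of w] by (rule DERIV_subset) (simp add: S_def)
      then show "((\<lambda>s. p s \<bullet> w - s * (G t \<bullet> w)) has_field_derivative (G s \<bullet> w - G t \<bullet> w)) (at s within S)"
        by (auto intro!: derivative_eq_intros)
      have "norm (G s - G t) \<le> e"
        using d(2)[OF s0] s by (simp add: S_def dist_norm abs_minus_commute less_imp_le)
      then have "\<bar>(G s - G t) \<bullet> w\<bar> \<le> e * norm w"
        by (meson Cauchy_Schwarz_ineq2 mult_right_mono norm_ge_zero order_trans)
      then show "norm (G s \<bullet> w - G t \<bullet> w) \<le> e * norm w"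
        by (simp add: inner_diff_left)
    qed (use y t d in \<open>auto simp: S_def dist_norm\<close>)
    moreover have "(p y \<bullet> w - y * (G t \<bullet> w)) - (p t \<bullet> w - t * (G t \<bullet> w)) = w \<bullet> w"
      by (simp add: w_def inner_diff_left algebra_simps)
    ultimately have "norm w * norm w \<le> (e * norm (y - t)) * norm w"
      by (simp add: dot_square_norm power2_eq_square mult_ac)
    then show "norm (p y - p t - (y - t) *\<^sub>R G t) \<le> e * norm (y - t)"
      unfolding w_def[symmetric] using \<open>e > 0\<close> by (cases "norm w = 0") auto
  qed
qed

text \<open>Gronwall's argument: \<open>exp (k * s) * F s\<close> has nonpositive
  derivative.\<close>

lemma exponential_decay:
  fixes F F' :: "real \<Rightarrow> real"
  assumes der: "\<And>t. t \<ge> 0 \<Longrightarrow> (F has_real_derivative F' t) (at t within {0..})"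
    and le: "\<And>t. t \<ge> 0 \<Longrightarrow> F' t \<le> - k * F t" and t: "t \<ge> 0"
  shows "F t \<le> exp (- k * t) * F 0"
proof -
  have der': "((\<lambda>s. exp (k * s) * F s) has_real_derivative exp (k * s) * (k * F s + F' s)) (at s within {0..})"
    if "s \<ge> 0" for s
    using der[OF that] by (auto intro!: derivative_eq_intros simp: algebra_simps)
  have "exp (k * t) * F t \<le> exp (k * 0) * F 0"
  proof (rule DERIV_nonpos_imp_decreasing_open[OF t])
    fix s assume s: "0 < s" "s < t"
    \<comment> \<open>The one-sided derivative is two-sided at interior points; the endpoints enter
      only through continuity.\<close>
    then have "at s within {0..} = at s"
      by (intro at_within_interior) simp
    with der'[of s] s have "((\<lambda>s. exp (k * s) * F s) has_real_derivative exp (k * s) * (k * F s + F' s)) (at s)"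
      by simp
    moreover have "exp (k * s) * (k * F s + F' s) \<le> 0"
      using le[of s] s by (simp add: mult_le_0_iff)
    ultimately show "\<exists>y. ((\<lambda>s. exp (k * s) * F s) has_real_derivative y) (at s) \<and> y \<le> 0"
      by blast
  next
    show "continuous_on {0..t} (\<lambda>s. exp (k * s) * F s)"
      by (rule continuous_on_subset[of "{0..}"])
         (auto simp: continuous_on_eq_continuous_within intro!: DERIV_continuous der')
  qed
  then have "exp (- (k * t)) * (exp (k * t) * F t) \<le> exp (- (k * t)) * F 0"
    by (intro mult_left_mono) auto
  then show ?thesis
    by (simp add: mult.assoc[symmetric] exp_add[symmetric])
qed

text \<open>The damping controls only \<open>p\<close>; the term
  \<open>\<epsilon> * (v t \<bullet> p t)\<close> adds the missing dissipation
  \<open>- \<epsilon> * (S (v t) \<bullet> v t)\<close>. The first condition on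
  \<open>\<epsilon>\<close> keeps \<open>F\<close> between \<open>e / 4\<close> and
  \<open>3 / 4 * e\<close>, the second lets the damping absorb the errors. Then \<open>F' \<le> -
  (\<epsilon> / 2) * e \<le> - (2 * \<epsilon> / 3) * F\<close>, and the prefactor \<open>3\<close>
  is the ratio of the two comparison constants.\<close>

lemma damped_wave_decay:
  fixes v p :: "real \<Rightarrow> 'h::real_inner" and S R :: "'h \<Rightarrow> 'h"
  assumes S: "bounded_linear S" and S_sym: "\<And>x y. S x \<bullet> y = x \<bullet> S y"
    and v: "\<And>t. t \<ge> 0 \<Longrightarrow> (v has_vector_derivative p t) (at t within {0..})"
    and p: "\<And>t. t \<ge> 0 \<Longrightarrow> (p has_vector_derivative - (S (v t) + c *\<^sub>R R (p t))) (at t within {0..})"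
    and S_ge: "\<And>t. t \<ge> 0 \<Longrightarrow> l * (norm (v t))\<^sup>2 \<le> S (v t) \<bullet> v t"
    and R_ge: "\<And>t. t \<ge> 0 \<Longrightarrow> r * (norm (p t))\<^sup>2 \<le> R (p t) \<bullet> p t"
    and R_le: "\<And>t. t \<ge> 0 \<Longrightarrow> norm (R (p t)) \<le> 2 * r * norm (p t)"
    and pos: "l > 0" "r > 0" "c > 0" "\<epsilon> > 0"
    and eps: "\<epsilon>\<^sup>2 \<le> l / 4" "\<epsilon> * (1 + 2 * c\<^sup>2 * r\<^sup>2 / l) \<le> c * r / 2"
    and t: "t \<ge> 0"
  shows "l * (norm (v t))\<^sup>2 \<le> 3 * exp (- (2 * \<epsilon> / 3) * t) * ((norm (p 0))\<^sup>2 + S (v 0) \<bullet> v 0)"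
proof -
  define e where "e t = p t \<bullet> p t + S (v t) \<bullet> v t" for t
  define F where "F t = e t / 2 + \<epsilon> * (v t \<bullet> p t)" for t
  define F' where "F' t = \<epsilon> * (norm (p t))\<^sup>2 - c * (R (p t) \<bullet> p t)
     - \<epsilon> * (S (v t) \<bullet> v t) - \<epsilon> * c * (v t \<bullet> R (p t))" for t
  have F_der: "(F has_real_derivative F' t) (at t within {0..})" if "t \<ge> 0" for t
  proof -
    note Sv = bounded_linear.has_vector_derivative[OF S v[OF that]]
    note inner_der = bounded_bilinear.has_vector_derivative[OF bounded_bilinear_inner,
        folded has_real_derivative_iff_has_vector_derivative]
    note a = inner_der[OF p[OF that] p[OF that]] and b = inner_der[OF Sv v[OF that]]
      and d = inner_der[OF v[OF that] p[OF that]]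
    have sw: "S (p t) \<bullet> v t = S (v t) \<bullet> p t" "p t \<bullet> S (v t) = S (v t) \<bullet> p t"
      "p t \<bullet> R (p t) = R (p t) \<bullet> p t" "v t \<bullet> S (v t) = S (v t) \<bullet> v t"
      using S_sym[of "p t" "v t"] inner_commute[of "S (v t)" "p t"] inner_commute[of "R (p t)" "p t"]
        inner_commute[of "S (v t)" "v t"] by simp_all
    from DERIV_add[OF DERIV_cdivide[OF DERIV_add[OF a b], of 2] DERIV_cmult[OF d, of \<epsilon>]]
    show ?thesis
      unfolding F_def e_def
      by (rule DERIV_cong) (simp add: F'_def inner_simps sw power2_norm_eq_inner algebra_simps)
  qed
  have bounds: "\<epsilon> * \<bar>v t \<bullet> p t\<bar> \<le> e t / 4" "F' t \<le> - (\<epsilon> / 2) * e t" if t: "t \<ge> 0" for t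
  proof -
    \<comment> \<open>Plays the role of the norm of \<open>v t\<close> under the square root of
      \<open>S\<close>.\<close>
    define s where "s = sqrt (S (v t) \<bullet> v t)"
    have Sv: "S (v t) \<bullet> v t = s\<^sup>2"
      unfolding s_def using S_ge[OF t] pos
      by (intro real_sqrt_pow2[symmetric]) (meson mult_nonneg_nonneg less_imp_le order_trans zero_le_power2)
    have s: "s \<ge> 0" unfolding s_def using Sv by simp
    have lv: "sqrt l * norm (v t) \<le> s"
      unfolding s_def using S_ge[OF t] pos by (intro real_le_rsqrt) (simp add: power_mult_distrib)
    have sl: "sqrt l > 0" "(sqrt l)\<^sup>2 = l" using pos by auto
    have "\<epsilon> \<le> sqrt l / 2"
      by (rule power2_le_imp_le) (use eps(1) sl in \<open>simp_all add: power_divide\<close>)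
    then have "\<epsilon> * norm (v t) \<le> sqrt l / 2 * norm (v t)"
      by (intro mult_right_mono) auto
    also have "\<dots> \<le> s / 2" using lv by simp
    finally have ev: "\<epsilon> * norm (v t) \<le> s / 2" .
    have "\<epsilon> * \<bar>v t \<bullet> p t\<bar> \<le> \<epsilon> * (norm (v t) * norm (p t))"
      using pos by (intro mult_left_mono Cauchy_Schwarz_ineq2) auto
    also have "\<dots> = (\<epsilon> * norm (v t)) * norm (p t)" by simp
    also have "\<dots> \<le> s / 2 * norm (p t)"
      by (intro mult_right_mono ev) auto
    also have "\<dots> \<le> ((norm (p t))\<^sup>2 + s\<^sup>2) / 4"
      using zero_le_power2[of "norm (p t) - s"] by (simp add: power2_eq_square algebra_simps)
    finally show "\<epsilon> * \<bar>v t \<bullet> p t\<bar> \<le> e t / 4"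
      by (simp add: e_def Sv power2_norm_eq_inner)
    \<comment> \<open>Chosen so that the cross term is at most \<open>s * b\<close>; Young's
      inequality then leaves half of \<open>s\<^sup>2\<close> for the decay.\<close>
    define b where "b = 2 * c * r / sqrt l * norm (p t)"
    have b2: "b\<^sup>2 / 2 = 2 * c\<^sup>2 * r\<^sup>2 / l * (norm (p t))\<^sup>2"
      by (simp add: b_def power_mult_distrib power_divide sl)
    have "c * \<bar>v t \<bullet> R (p t)\<bar> \<le> c * (norm (v t) * (2 * r * norm (p t)))"
      using pos R_le[OF t]
      by (intro mult_left_mono order_trans[OF Cauchy_Schwarz_ineq2]) auto
    also have "\<dots> = (sqrt l * norm (v t)) * b"
      using sl by (simp add: b_def)
    also have "\<dots> \<le> s * b"
      using pos sl by (intro mult_right_mono lv) (auto simp: b_def)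
    also have "\<dots> \<le> s\<^sup>2 / 2 + b\<^sup>2 / 2"
      using zero_le_power2[of "s - b"] by (simp add: power2_eq_square algebra_simps)
    finally have cross: "c * \<bar>v t \<bullet> R (p t)\<bar> \<le> s\<^sup>2 / 2 + 2 * c\<^sup>2 * r\<^sup>2 / l * (norm (p t))\<^sup>2"
      by (simp only: b2)
    have "- (\<epsilon> * c * (v t \<bullet> R (p t))) \<le> \<epsilon> * (c * \<bar>v t \<bullet> R (p t)\<bar>)"
      using mult_left_mono[OF abs_ge_minus_self[of "v t \<bullet> R (p t)"], of "\<epsilon> * c"] pos
      by (simp add: mult.assoc)
    also have "\<dots> \<le> \<epsilon> * (s\<^sup>2 / 2 + 2 * c\<^sup>2 * r\<^sup>2 / l * (norm (p t))\<^sup>2)"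
      using pos by (intro mult_left_mono cross) auto
    finally have 1: "- (\<epsilon> * c * (v t \<bullet> R (p t))) \<le>
        \<epsilon> * s\<^sup>2 / 2 + \<epsilon> * (2 * c\<^sup>2 * r\<^sup>2 / l) * (norm (p t))\<^sup>2"
      by (simp add: distrib_left)
    have 2: "c * r * (norm (p t))\<^sup>2 \<le> c * (R (p t) \<bullet> p t)"
      using mult_left_mono[OF R_ge[OF t], of c] pos by (simp add: mult.assoc)
    have 3: "\<epsilon> * (norm (p t))\<^sup>2 + \<epsilon> * (2 * c\<^sup>2 * r\<^sup>2 / l) * (norm (p t))\<^sup>2 \<le> (c * r * (norm (p t))\<^sup>2) / 2"
      using mult_right_mono[OF eps(2), of "(norm (p t))\<^sup>2"] by (simp add: distrib_left distrib_right)
    \<comment> \<open>Fact \<open>3\<close> uses up half of the damping; the other half has to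
      dominate \<open>\<epsilon> * (norm (p t))\<^sup>2 / 2\<close>, which is what fact
      \<open>4\<close> gives.\<close>
    have "\<epsilon> * 1 \<le> \<epsilon> * (1 + 2 * c\<^sup>2 * r\<^sup>2 / l)"
      using pos by (intro mult_left_mono) auto
    also have "\<dots> \<le> c * r"
      using eps(2) pos by (smt (verit) field_sum_of_halves mult_pos_pos)
    finally have 4: "\<epsilon> * (norm (p t))\<^sup>2 \<le> c * r * (norm (p t))\<^sup>2"
      by (intro mult_right_mono) auto
    have "F' t = \<epsilon> * (norm (p t))\<^sup>2 - c * (R (p t) \<bullet> p t) - \<epsilon> * s\<^sup>2 - \<epsilon> * c * (v t \<bullet> R (p t))"
      by (simp add: F'_def Sv)
    also have "\<dots> \<le> - (\<epsilon> * (norm (p t))\<^sup>2) / 2 - (\<epsilon> * s\<^sup>2) / 2"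
      using 1 2 3 4 by linarith
    also have "\<dots> = - (\<epsilon> / 2) * e t"
      by (simp add: e_def Sv power2_norm_eq_inner algebra_simps)
    finally show "F' t \<le> - (\<epsilon> / 2) * e t" .
  qed
  have equiv: "e t / 4 \<le> F t" "F t \<le> 3 / 4 * e t" if "t \<ge> 0" for t
  proof -
    have "\<bar>\<epsilon> * (v t \<bullet> p t)\<bar> \<le> e t / 4"
      using bounds(1)[OF that] pos by (simp add: abs_mult)
    then show "e t / 4 \<le> F t" "F t \<le> 3 / 4 * e t"
      unfolding F_def by linarith+
  qed
  have "F t \<le> exp (- (2 * \<epsilon> / 3) * t) * F 0"
  proof (rule exponential_decay[OF F_der _ t])
    fix s :: real assume s: "s \<ge> 0"
    have "\<epsilon> * F s \<le> \<epsilon> * (3 / 4 * e s)"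
      using equiv(2)[OF s] pos by (intro mult_left_mono) auto
    then show "F' s \<le> - (2 * \<epsilon> / 3) * F s"
      using bounds(2)[OF s] by (simp add: algebra_simps)
  qed
  also have "\<dots> \<le> exp (- (2 * \<epsilon> / 3) * t) * (3 / 4 * e 0)"
    using equiv(2)[of 0] by (intro mult_left_mono) auto
  finally have "e t \<le> 3 * exp (- (2 * \<epsilon> / 3) * t) * e 0"
    using equiv(1)[OF t] by linarith
  moreover have "l * (norm (v t))\<^sup>2 \<le> e t"
    using S_ge[OF t] inner_ge_zero[of "p t"] unfolding e_def by linarith
  ultimately show ?thesis
    by (simp add: e_def power2_norm_eq_inner)
qed

context positive_spectral
begin

text \<open>Tested against vectors \<open>E B w\<close>, the weak equation becomes an ordinary
  differential equation with bounded coefficients, to which \<open>damped_wave_decay\<close>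
  applies. Neither \<open>\<rho>\<close> nor the prefactor depends on \<open>l\<close>:
  \<open>\<rho> \<le> 1/2\<close> and \<open>\<rho> * (1 + 2 * c\<^sup>2) \<le> c / 2\<close> are
  exactly what the two conditions on \<open>\<epsilon>\<close> require.\<close>

lemma window_decay:
  fixes c \<alpha> l :: real
  assumes sol: "energy_solution A c \<alpha> u\<^sub>0 u\<^sub>1 u"
    and c: "c > 0" and \<alpha>: "0 < \<alpha>" "\<alpha> < 1" and l: "l \<ge> 1"
    and B: "B \<in> sets borel" "B \<subseteq> {l..2 * l}" and t: "t \<ge> 0"
  defines "\<rho> \<equiv> min (1/2) (c / (2 * (1 + 2 * c\<^sup>2)))"
  shows "(norm (E B (u t)))\<^sup>2 \<le>
    3 * exp (- (2 * (\<rho> * l powr min \<alpha> (1 - \<alpha>)) / 3) * t) * ((norm u\<^sub>1)\<^sup>2 + 2 * (norm u\<^sub>0)\<^sup>2)"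
proof -
  obtain u' where u: "\<And>t. t \<ge> 0 \<Longrightarrow> (u has_vector_derivative u' t) (at t within {0..})"
    and u'_cont: "continuous_on {0..} u'" and init: "u 0 = u\<^sub>0" "u' 0 = u\<^sub>1"
    and eqn: "\<And>w. w \<in> Domain A \<Longrightarrow> \<exists>g.
          (\<forall>t\<ge>0. ((\<lambda>s. u' s \<bullet> w) has_real_derivative g t) (at t within {0..})) \<and>
          (\<forall>t\<ge>0. g t + u t \<bullet> app A w + c * (u' t \<bullet> app (frac_power A \<alpha>) w) = 0)"
    using sol unfolding energy_solution_def by (elim conjE exE) (rule that, blast+)
  have bd: "bdd B"
    using B bounded_subset[OF bounded_closed_interval] by (auto simp: bdd_def)
  have B0: "B \<subseteq> {0..}" using B(2) l by auto
  have EE: "E B (E B x) = E B x" for x by (rule proj_idem[OF B(1)])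
  have \<alpha>0: "\<alpha> \<ge> 0" using \<alpha> by simp
  note Sbd = bounded_on_id[OF bd] and Rbd = app_frac_power_proj(1)[OF bd B0 EE \<alpha>0]
  define S where "S = compression B (\<lambda>l. l)"
  define R where "R = compression B (\<lambda>l. l powr \<alpha>)"
  interpret EB: bounded_linear "E B" by (rule bounded_linear_proj[OF B(1)])
  have S: "bounded_linear S" and R: "bounded_linear R"
    unfolding S_def R_def by (rule bounded_linear_compression[OF Sbd] bounded_linear_compression[OF Rbd])+
  define v where "v t = E B (u t)" for t
  define p where "p t = E B (u' t)" for t
  have v: "(v has_vector_derivative p t) (at t within {0..})" if "t \<ge> 0" for t
    unfolding v_def p_def by (rule EB.has_vector_derivative[OF u[OF that]])
  have v_cont: "continuous_on {0..} v"
    unfolding continuous_on_eq_continuous_within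
    by (auto intro: has_vector_derivative_continuous[OF v])
  have p_cont: "continuous_on {0..} p"
    unfolding p_def by (rule EB.continuous_on[OF u'_cont])
  have p: "(p has_vector_derivative - (S (v t) + c *\<^sub>R R (p t))) (at t within {0..})" if "t \<ge> 0" for t
  proof (rule has_vector_derivative_of_weak[OF _ _ that])
    show "continuous_on {0..} (\<lambda>t. - (S (v t) + c *\<^sub>R R (p t)))"
      by (intro continuous_intros bounded_linear.continuous_on[OF S v_cont]
          bounded_linear.continuous_on[OF R p_cont])
    fix w and s :: real assume s: "s \<ge> 0"
    \<comment> \<open>The weak equation admits only test vectors in \<open>Domain A\<close>. The
      projection of an arbitrary \<open>w\<close> onto the bounded window is one, and it moves onto
      \<open>u\<close> and \<open>u'\<close> by symmetry.\<close>
    have "E B w \<in> Domain A"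
      using operator_proj[OF bd EE] by blast
    from eqn[OF this] obtain g where
      g: "((\<lambda>s. u' s \<bullet> E B w) has_real_derivative g s) (at s within {0..})"
        "g s + u s \<bullet> app A (E B w) + c * (u' s \<bullet> app (frac_power A \<alpha>) (E B w)) = 0"
      using s by blast
    have "app A (E B w) = S w"
      using app_proj[OF bd EE, of w] by (simp add: S_def compression_proj[OF Sbd])
    then have 1: "u s \<bullet> app A (E B w) = S (v s) \<bullet> w"
      by (simp add: S_def v_def compression_proj[OF Sbd] compression_sym[OF Sbd])
    have "app (frac_power A \<alpha>) (E B w) = R w"
      using app_frac_power_proj(2)[OF bd B0 EE \<alpha>0, of w] by (simp add: R_def compression_proj[OF Rbd])
    then have 2: "u' s \<bullet> app (frac_power A \<alpha>) (E B w) = R (p s) \<bullet> w"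
      by (simp add: R_def p_def compression_proj[OF Rbd] compression_sym[OF Rbd])
    have "g s = - (S (v s) + c *\<^sub>R R (p s)) \<bullet> w"
      using g(2) unfolding 1 2 by (simp add: inner_simps)
    moreover have "(\<lambda>s. u' s \<bullet> E B w) = (\<lambda>s. p s \<bullet> w)"
      by (simp add: p_def proj_sym[OF B(1)])
    ultimately show "((\<lambda>s. p s \<bullet> w) has_real_derivative - (S (v s) + c *\<^sub>R R (p s)) \<bullet> w) (at s within {0..})"
      using g(1) by simp
  qed
  define r where "r = l powr \<alpha>"
  define \<gamma> where "\<gamma> = min \<alpha> (1 - \<alpha>)"
  define \<epsilon> where "\<epsilon> = \<rho> * l powr \<gamma>"
  have K: "1 + 2 * c\<^sup>2 > 0"
    using zero_le_power2[of c] by linarith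
  then have \<rho>: "0 < \<rho>" "\<rho> \<le> 1/2"
    using c min.cobounded1[of "1/2" "c / (2 * (1 + 2 * c\<^sup>2))"] by (simp_all only: \<rho>_def) simp
  have "\<rho> * (1 + 2 * c\<^sup>2) \<le> c / (2 * (1 + 2 * c\<^sup>2)) * (1 + 2 * c\<^sup>2)"
    unfolding \<rho>_def using K by (intro mult_right_mono min.cobounded2) auto
  also have "\<dots> = c / 2"
  proof -
    have "c / (2 * z) * z = c / 2" if "z > 0" for z :: real
      using that by simp
    from this[OF K] show ?thesis .
  qed
  finally have \<rho>K: "\<rho> * (1 + 2 * c\<^sup>2) \<le> c / 2" .
  have r: "r > 0" and \<epsilon>: "\<epsilon> > 0"
    using l \<rho> by (auto simp: r_def \<epsilon>_def)
  \<comment> \<open>Here \<open>2 * \<gamma> \<le> 1\<close> and \<open>l \<ge> 1\<close> give the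
    power of \<open>l\<close>, and \<open>\<rho> \<le> 1/2\<close> gives the factor
    \<open>1/4\<close>.\<close>
  have eps1: "\<epsilon>\<^sup>2 \<le> l / 4"
  proof -
    have "(l powr \<gamma>)\<^sup>2 = l powr (2 * \<gamma>)"
      by (simp add: power2_eq_square powr_add[symmetric])
    also have "\<dots> \<le> l powr 1"
      using l by (intro powr_mono) (auto simp: \<gamma>_def min_def)
    finally have "(l powr \<gamma>)\<^sup>2 \<le> l" using l by simp
    moreover have "\<rho>\<^sup>2 \<le> (1/2)\<^sup>2"
      using \<rho> by (intro power_mono) auto
    ultimately have "\<rho>\<^sup>2 * (l powr \<gamma>)\<^sup>2 \<le> (1/2)\<^sup>2 * l"
      by (intro mult_mono) auto
    then show ?thesis by (simp add: \<epsilon>_def power_mult_distrib power_divide)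
  qed
  have eps2: "\<epsilon> * (1 + 2 * c\<^sup>2 * r\<^sup>2 / l) \<le> c * r / 2"
  proof -
    \<comment> \<open>The damping absorbs \<open>\<epsilon> |v'|\<^sup>2\<close> because \<open>\<gamma> \<le> \<alpha>\<close>, and the cross term because \<open>\<gamma> \<le> 1 - \<alpha>\<close>.\<close>
    have 1: "\<epsilon> \<le> \<rho> * r"
      unfolding \<epsilon>_def r_def using l \<rho> by (intro mult_left_mono powr_mono) (auto simp: \<gamma>_def)
    have "l powr \<gamma> * (r\<^sup>2 / l) = l powr (\<gamma> + 2 * \<alpha> - 1)"
      using l by (simp add: r_def power2_eq_square powr_add powr_diff flip: powr_add)
    also have "\<dots> \<le> r"
      unfolding r_def using l by (intro powr_mono) (auto simp: \<gamma>_def min_def)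
    finally have "l powr \<gamma> * (r\<^sup>2 / l) \<le> r" .
    from mult_left_mono[OF this, of \<rho>] \<rho> have 2: "\<epsilon> * (r\<^sup>2 / l) \<le> \<rho> * r"
      by (simp add: \<epsilon>_def mult.assoc)
    have "\<epsilon> * (1 + 2 * c\<^sup>2 * r\<^sup>2 / l) = \<epsilon> + 2 * c\<^sup>2 * (\<epsilon> * (r\<^sup>2 / l))"
      by (simp add: algebra_simps)
    also have "\<dots> \<le> \<rho> * r + 2 * c\<^sup>2 * (\<rho> * r)"
      by (intro add_mono 1 mult_left_mono 2) auto
    also have "\<dots> = (\<rho> * (1 + 2 * c\<^sup>2)) * r"
      by (simp add: algebra_simps)
    also have "\<dots> \<le> c / 2 * r"
      using r \<rho>K by (intro mult_right_mono) auto
    finally show ?thesis by simp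
  qed
  have "l * (norm (v t))\<^sup>2 \<le>
      3 * exp (- (2 * \<epsilon> / 3) * t) * ((norm (p 0))\<^sup>2 + S (v 0) \<bullet> v 0)"
  proof (rule damped_wave_decay[OF S _ v p _ _ _ _ r c \<epsilon> eps1 eps2 t])
    show "S x \<bullet> y = x \<bullet> S y" for x y
      unfolding S_def by (rule compression_sym[OF Sbd])
    fix t :: real
    show "l * (norm (v t))\<^sup>2 \<le> S (v t) \<bullet> v t"
      unfolding S_def by (rule compression_inner_ge[OF Sbd]) (use B in \<open>auto simp: v_def EE\<close>)
    show "r * (norm (p t))\<^sup>2 \<le> R (p t) \<bullet> p t"
      unfolding R_def r_def
      by (rule compression_inner_ge[OF Rbd]) (use B \<alpha> l in \<open>auto simp: p_def EE intro!: powr_mono2\<close>)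
    \<comment> \<open>The window has ratio \<open>2\<close> between its ends, and
      \<open>2 powr \<alpha> \<le> 2\<close>; this is the factor \<open>2\<close> allowed on
      \<open>R\<close>.\<close>
    have "norm (R (p t)) \<le> (2 * l) powr \<alpha> * norm (p t)"
      unfolding R_def by (rule norm_compression_le[OF Rbd]) (use B B0 \<alpha> l in \<open>auto intro!: powr_mono2\<close>)
    also have "\<dots> \<le> (2 powr 1 * r) * norm (p t)"
      using l \<alpha> by (intro mult_right_mono) (auto simp: r_def powr_mult intro!: powr_mono[of \<alpha> 1 2, simplified])
    finally show "norm (R (p t)) \<le> 2 * r * norm (p t)" by simp
  qed (use l in auto)
  \<comment> \<open>The initial energy in the window is at most \<open>l\<close> times a fixed
    quantity, as \<open>S\<close> has norm at most \<open>2 * l\<close> and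
    \<open>l \<ge> 1\<close>. This \<open>l\<close> cancels the one on the left, so the norms of the
    initial data in \<open>H\<close> suffice.\<close>
  also have "\<dots> \<le> 3 * exp (- (2 * \<epsilon> / 3) * t) * (l * ((norm u\<^sub>1)\<^sup>2 + 2 * (norm u\<^sub>0)\<^sup>2))"
  proof (rule mult_left_mono)
    have "norm (p 0) \<le> norm u\<^sub>1" "norm (v 0) \<le> norm u\<^sub>0"
      by (simp_all add: p_def v_def init norm_proj_le[OF B(1)])
    then have le: "(norm (p 0))\<^sup>2 \<le> (norm u\<^sub>1)\<^sup>2" "(norm (v 0))\<^sup>2 \<le> (norm u\<^sub>0)\<^sup>2"
      by (auto intro: power_mono)
    have "S (v 0) \<bullet> v 0 \<le> norm (S (v 0)) * norm (v 0)"
      by (rule norm_cauchy_schwarz)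
    also have "\<dots> \<le> ((2 * l) * norm (v 0)) * norm (v 0)"
      unfolding S_def by (intro mult_right_mono norm_compression_le[OF Sbd]) (use l B in auto)
    also have "\<dots> = 2 * l * (norm (v 0))\<^sup>2"
      by (simp add: power2_eq_square)
    also have "\<dots> \<le> 2 * l * (norm u\<^sub>0)\<^sup>2"
      using l by (intro mult_left_mono le) auto
    finally have "S (v 0) \<bullet> v 0 \<le> 2 * l * (norm u\<^sub>0)\<^sup>2" .
    moreover have "1 * (norm u\<^sub>1)\<^sup>2 \<le> l * (norm u\<^sub>1)\<^sup>2"
      using l by (intro mult_right_mono) auto
    moreover have "l * ((norm u\<^sub>1)\<^sup>2 + 2 * (norm u\<^sub>0)\<^sup>2) = l * (norm u\<^sub>1)\<^sup>2 + 2 * l * (norm u\<^sub>0)\<^sup>2"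
      by (simp add: algebra_simps)
    ultimately show "(norm (p 0))\<^sup>2 + S (v 0) \<bullet> v 0 \<le> l * ((norm u\<^sub>1)\<^sup>2 + 2 * (norm u\<^sub>0)\<^sup>2)"
      using le(1) by linarith
  qed simp
  also have "\<dots> = l * (3 * exp (- (2 * \<epsilon> / 3) * t) * ((norm u\<^sub>1)\<^sup>2 + 2 * (norm u\<^sub>0)\<^sup>2))"
    by (simp only: mult_ac)
  finally show ?thesis
    using l by (simp add: v_def \<epsilon>_def \<gamma>_def mult_le_cancel_left_pos)
qed

end

section \<open>Summation over dyadic windows\<close>

text \<open>The Hilbert space is only known to be a \<^class>\<open>complete_space\<close>, so the library's results on
  series in a \<^class>\<open>banach\<close> space do not apply.\<close>

lemma sums_of_summable_norm:
  fixes f :: "nat \<Rightarrow> 'h::{real_normed_vector, complete_space}"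
  assumes "summable (\<lambda>k. norm (f k))"
  shows "\<exists>s. f sums s \<and> norm s \<le> (\<Sum>k. norm (f k))"
proof -
  have "Cauchy (\<lambda>n. \<Sum>k<n. f k)"
  proof (rule metric_CauchyI)
    fix e :: real assume "e > 0"
    then obtain N where N: "\<And>m n. N \<le> m \<Longrightarrow> norm (\<Sum>k\<in>{m..<n}. norm (f k)) < e"
      using assms unfolding summable_Cauchy by blast
    have *: "dist (\<Sum>k<m. f k) (\<Sum>k<n. f k) < e" if "N \<le> m" "m \<le> n" for m n
    proof -
      have "(\<Sum>k<n. f k) - (\<Sum>k<m. f k) = (\<Sum>k\<in>{m..<n}. f k)"
        using sum_diff_nat_ivl[of 0 m n f] that by (simp add: atLeast0LessThan)
      then have "dist (\<Sum>k<m. f k) (\<Sum>k<n. f k) = norm (\<Sum>k\<in>{m..<n}. f k)"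
        by (metis dist_commute dist_norm)
      also have "\<dots> \<le> (\<Sum>k\<in>{m..<n}. norm (f k))"
        by (rule norm_sum)
      also have "\<dots> < e"
        using N[OF that(1), of n] by simp
      finally show ?thesis .
    qed
    show "\<exists>N. \<forall>m\<ge>N. \<forall>n\<ge>N. dist (\<Sum>k<m. f k) (\<Sum>k<n. f k) < e"
    proof (intro exI allI impI)
      fix m n assume "N \<le> m" "N \<le> n"
      then show "dist (\<Sum>k<m. f k) (\<Sum>k<n. f k) < e"
        using *[of m n] *[of n m] by (cases "m \<le> n") (auto simp: dist_commute)
    qed
  qed
  then obtain s where s: "f sums s"
    using Cauchy_convergent unfolding sums_def convergent_def by blast
  have "norm s \<le> (\<Sum>k. norm (f k))"
  proof (rule LIMSEQ_le_const2)
    show "(\<lambda>n. norm (\<Sum>k<n. f k)) \<longlonglongrightarrow> norm s"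
      using s unfolding sums_def by (rule tendsto_norm)
    have "norm (\<Sum>k<n. f k) \<le> (\<Sum>k. norm (f k))" for n
      by (rule order_trans[OF norm_sum sum_le_suminf[OF assms]]) auto
    then show "\<exists>N. \<forall>n\<ge>N. norm (\<Sum>k<n. f k) \<le> (\<Sum>k. norm (f k))" by blast
  qed
  with s show ?thesis by blast
qed

text \<open>Raise \<open>z \<le> exp z\<close> at \<open>z = y / m\<close> to the power
  \<open>m\<close>. The factor \<open>m powr m\<close> is the origin of the Gevrey growth.\<close>

lemma powr_mult_exp_le:
  fixes y m :: real
  assumes "y \<ge> 0" "m > 0"
  shows "y powr m * exp (- y) \<le> m powr m"
proof -
  have "y / m \<le> exp (y / m)"
    using exp_ge_add_one_self[of "y / m"] by linarith
  then have "(y / m) powr m \<le> exp (y / m) powr m"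
    using assms by (intro powr_mono2) auto
  also have "\<dots> = exp y"
    using assms by (simp add: exp_powr_real)
  finally have "y powr m \<le> exp y * m powr m"
    using assms by (simp add: powr_divide field_simps)
  then show ?thesis
    by (simp add: exp_minus field_simps)
qed

text \<open>Window \<open>0\<close> holds the low frequencies, for which no decay is claimed. Window
  \<open>Suc k\<close> starts at \<open>2 ^ k \<ge> 1\<close>, as \<open>window_decay\<close>
  demands.\<close>

definition dyadic :: "nat \<Rightarrow> real set" where
  "dyadic k = (if k = 0 then {0..<1} else {2 ^ (k - 1)..<2 ^ k})"

lemma dyadic_subset: "dyadic k \<subseteq> {0..2 ^ k}"
proof
  fix l assume l: "l \<in> dyadic k"
  have "(0::real) \<le> 2 ^ (k - 1)" by simp
  moreover have "2 ^ (k - 1) \<le> l \<or> 0 \<le> l" "l \<le> 2 ^ k"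
    using l by (auto simp: dyadic_def split: if_splits)
  ultimately show "l \<in> {0..2 ^ k}"
    unfolding atLeastAtMost_iff by linarith
qed

lemma dyadic_Suc_subset: "dyadic (Suc k) \<subseteq> {2 ^ k..2 * 2 ^ k}"
  by (auto simp: dyadic_def)

lemma dyadic_borel [measurable]: "dyadic k \<in> sets borel"
  by (auto simp: dyadic_def)

lemma disjoint_dyadic: "disjoint_family dyadic"
proof -
  have "dyadic i \<inter> dyadic j = {}" if ij: "i < j" for i j
  proof (rule ccontr)
    assume "dyadic i \<inter> dyadic j \<noteq> {}"
    then obtain l :: real where "l < 2 ^ i" "2 ^ (j - 1) \<le> l"
      using ij by (auto simp: dyadic_def split: if_splits)
    moreover have "(2::real) ^ i \<le> 2 ^ (j - 1)"
      using ij by (intro power_increasing) auto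
    ultimately show False by linarith
  qed
  then show ?thesis
    unfolding disjoint_family_on_def by (metis Int_commute nat_neq_iff)
qed

lemma UN_dyadic: "(\<Union>k. dyadic k) = {0..}"
proof (intro equalityI subsetI)
  fix l :: real assume "l \<in> {0..}"
  then have l: "l \<ge> 0" by simp
  obtain n where "l < 2 ^ n"
    using real_arch_pow[of 2 l] by auto
  then have ex: "\<exists>n. l < 2 ^ n" by blast
  define k where "k = (LEAST n. l < (2::real) ^ n)"
  have "l < 2 ^ k" unfolding k_def by (rule LeastI_ex[OF ex])
  moreover have "2 ^ (k - 1) \<le> l" if "k \<noteq> 0"
    using not_less_Least[of "k - 1" "\<lambda>n. l < (2::real) ^ n"] that by (auto simp: k_def not_less)
  ultimately have "l \<in> dyadic k"
    using l by (auto simp: dyadic_def)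
  then show "l \<in> (\<Union>k. dyadic k)" by blast
qed (use dyadic_subset in force)

section \<open>Powers of the operator and Gevrey bounds from window decay\<close>

context positive_spectral
begin

lemma single_valued_relpow: "(x, y) \<in> A ^^ n \<Longrightarrow> (x, z) \<in> A ^^ n \<Longrightarrow> y = z"
proof (induction n arbitrary: y z)
  case (Suc n)
  then show ?case by (auto simp: relcomp_unfold dest: operator_unique)
qed simp

text \<open>\<open>X n k\<close> is the \<open>n\<close>-th power of \<open>A\<close> applied to the
  component of \<open>x\<close> in window \<open>k\<close>, where \<open>A\<close> has norm at most
  \<open>2 ^ k\<close>. Closedness of \<open>A\<close> carries the relation between the partial sums
  of \<open>X n\<close> and \<open>X (Suc n)\<close> to their limits.\<close>

lemma relpow_dyadic:
  assumes sm: "\<And>n. n \<ge> 1 \<Longrightarrow> summable (\<lambda>k. (2 ^ k) ^ n * norm (E (dyadic k) x))"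
  shows "x \<in> Domain (A ^^ n)"
    and "n \<ge> 1 \<Longrightarrow> norm (app (A ^^ n) x) \<le> (\<Sum>k. (2 ^ k) ^ n * norm (E (dyadic k) x))"
proof -
  define T where "T k = compression (dyadic k) (\<lambda>l. l)" for k
  define X where "X n k = (T k ^^ n) (E (dyadic k) x)" for n k
  have bd: "bdd (dyadic k)" for k
    using bounded_subset[OF bounded_closed_interval dyadic_subset] by (simp add: bdd_def)
  note Tbd = bounded_on_id[OF bd]
  have X_Suc: "X (Suc n) k = T k (X n k)" for n k
    by (simp add: X_def)
  have X_proj: "E (dyadic k) (X n k) = X n k" for n k
    by (cases n) (simp_all add: X_Suc, simp_all add: X_def T_def proj_idem proj_compression[OF Tbd])
  have X_A: "(X n k, X (Suc n) k) \<in> A" for n k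
    unfolding X_Suc T_def by (rule operator_proj[OF bd X_proj])
  have X_le: "norm (X n k) \<le> (2 ^ k) ^ n * norm (E (dyadic k) x)" for n k
  proof (induction n)
    case (Suc n)
    have "norm (X (Suc n) k) \<le> 2 ^ k * norm (X n k)"
      unfolding X_Suc T_def using dyadic_subset[of k]
      by (intro norm_compression_le[OF Tbd]) auto
    also have "\<dots> \<le> 2 ^ k * ((2 ^ k) ^ n * norm (E (dyadic k) x))"
      by (intro mult_left_mono Suc.IH) auto
    finally show ?case by simp
  qed (simp add: X_def)
  have X_sums: "\<exists>y. X n sums y \<and> norm y \<le> (\<Sum>k. (2 ^ k) ^ n * norm (E (dyadic k) x))" if "n \<ge> 1" for n
  proof -
    have s: "summable (\<lambda>k. norm (X n k))"
      by (rule summable_comparison_test'[OF sm[OF that]]) (use X_le in simp)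
    have "(\<Sum>k. norm (X n k)) \<le> (\<Sum>k. (2 ^ k) ^ n * norm (E (dyadic k) x))"
      by (intro suminf_le X_le s sm that)
    then show ?thesis
      using sums_of_summable_norm[OF s] by (meson order_trans)
  qed
  \<comment> \<open>For \<open>n = 0\<close> convergence comes from countable additivity of
    \<open>E\<close>, which also identifies the limit as \<open>x\<close>.\<close>
  have "range dyadic \<subseteq> sets borel"
    using dyadic_borel by blast
  from proj_sums[OF this disjoint_dyadic, of x]
  have "(\<lambda>k. E (dyadic k) x) sums x"
    by (simp add: UN_dyadic proj_nonneg)
  moreover have "X 0 = (\<lambda>k. E (dyadic k) x)"
    by (simp add: X_def fun_eq_iff)
  ultimately have X0: "X 0 sums x" by simp
  have "\<exists>y. X n sums y" for n
    using X0 X_sums[of n] by (cases n) auto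
  then obtain y where y: "\<And>n. X n sums y n" by metis
  have y0: "y 0 = x" using y[of 0] X0 sums_unique2 by blast
  have subsp: "subspace A"
    using self_adjoint by (simp add: self_adjoint_def linear_operator_def)
  have step: "(y n, y (Suc n)) \<in> A" for n
  proof (rule operator_closed)
    show "(\<Sum>k<N. X n k, \<Sum>k<N. X (Suc n) k) \<in> A" for N
    proof (induction N)
      case 0
      then show ?case using subspace_0[OF subsp] by (simp add: zero_prod_def)
    next
      case (Suc N)
      then show ?case using subspace_add[OF subsp Suc X_A[of n N]] by simp
    qed
  qed (use y in \<open>auto simp: sums_def\<close>)
  have pow: "(x, y n) \<in> A ^^ n" for n
    by (induction n) (use y0 step in auto)
  then show "x \<in> Domain (A ^^ n)" by blast
  have "app (A ^^ n) x = y n"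
    using pow by (intro app_eq single_valued_relpow)
  moreover assume "n \<ge> 1"
  from X_sums[OF this] have "norm (y n) \<le> (\<Sum>k. (2 ^ k) ^ n * norm (E (dyadic k) x))"
    using y[of n] sums_unique2 by blast
  ultimately show "norm (app (A ^^ n) x) \<le> (\<Sum>k. (2 ^ k) ^ n * norm (E (dyadic k) x))"
    by simp
qed

text \<open>Split the exponential into two equal factors \<open>exp (- y)\<close>. One turns
  \<open>l ^ n\<close> into a constant to the power \<open>n\<close> times
  \<open>n powr (n / \<gamma>)\<close>, uniformly in the window; the other decays geometrically in
  \<open>k\<close> and makes the windows summable.\<close>

lemma gevrey_of_dyadic_decay:
  assumes decay: "\<And>k. norm (E (dyadic (Suc k)) x) \<le> D * exp (- b * (2 ^ k) powr \<gamma>)"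
    and b: "b > 0" and \<gamma>: "\<gamma> > 0"
  shows "x \<in> gevrey A (1 / \<gamma>)"
proof -
  have D: "D \<ge> 0"
    using decay[of 0] norm_ge_zero order_trans by (metis exp_gt_zero zero_le_mult_iff not_le)
  define q where "q = 2 powr - \<gamma>"
  \<comment> \<open>The leading \<open>2\<close> pays for the upper end \<open>2 * l\<close> of the
    window; the rest comes from \<open>powr_mult_exp_le\<close> with
    \<open>m = n / \<gamma>\<close>.\<close>
  define Q where "Q = 2 * (2 / (b * \<gamma>)) powr (1 / \<gamma>)"
  define G where "G n = real n powr (1 / \<gamma> * real n)" for n
  have q: "0 < q" "q < 1"
    using \<gamma> powr_less_mono[of "- \<gamma>" 0 2] by (auto simp: q_def)
  have Q: "Q > 0" using b \<gamma> by (simp add: Q_def)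
  have term_le: "(2 ^ Suc k) ^ n * norm (E (dyadic (Suc k)) x) \<le> (D * (2 / b) * Q ^ n * G n) * q ^ k"
    if n: "n \<ge> 1" for n k
  proof -
    define l :: real where "l = 2 ^ k"
    define y where "y = b * l powr \<gamma> / 2"
    define m where "m = real n / \<gamma>"
    have l: "l > 0" and y: "y > 0" and m: "m > 0"
      using b \<gamma> n by (simp_all add: l_def y_def m_def)
    have "l ^ n = (l powr \<gamma>) powr m"
      using l \<gamma> by (simp add: powr_powr m_def powr_realpow)
    also have "\<dots> = (2 / b * y) powr m"
      using b by (simp add: y_def)
    also have "\<dots> = (2 / b) powr m * y powr m"
      by (rule powr_mult)
    finally have "l ^ n * exp (- y) = (2 / b) powr m * (y powr m * exp (- y))"
      by simp
    also have "\<dots> \<le> (2 / b) powr m * m powr m"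
      using y m by (intro mult_left_mono powr_mult_exp_le) auto
    also have "\<dots> = (2 / b * m) powr m"
      by (rule powr_mult[symmetric])
    also have "2 / b * m = 2 / (b * \<gamma>) * real n"
      by (simp add: m_def)
    also have "\<dots> powr m = (2 / (b * \<gamma>)) powr m * real n powr m"
      by (rule powr_mult)
    also have "(2 / (b * \<gamma>)) powr m = ((2 / (b * \<gamma>)) powr (1 / \<gamma>)) ^ n"
      using b \<gamma> by (simp add: m_def powr_powr flip: powr_realpow)
    finally have 1: "l ^ n * exp (- y) \<le> ((2 / (b * \<gamma>)) powr (1 / \<gamma>)) ^ n * G n"
      by (simp add: G_def m_def)
    have "y \<le> exp y"
      using exp_ge_add_one_self[of y] by linarith
    then have "exp (- y) \<le> 1 / y"
      using y by (simp add: exp_minus field_simps)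
    also have "1 / y = 2 / b * (1 / l powr \<gamma>)"
      by (simp add: y_def)
    also have "l powr \<gamma> = (2 powr \<gamma>) ^ k"
      by (simp add: l_def powr_powr mult.commute flip: powr_realpow)
    also have "1 / (2 powr \<gamma>) ^ k = q ^ k"
      by (simp add: q_def powr_minus_divide power_one_over)
    finally have 2: "exp (- y) \<le> 2 / b * q ^ k" .
    have "(2 ^ Suc k) ^ n * norm (E (dyadic (Suc k)) x) \<le> (2 * l) ^ n * (D * exp (- b * l powr \<gamma>))"
      using decay[of k] by (intro mult_mono) (auto simp: l_def)
    also have "exp (- b * l powr \<gamma>) = exp (- y) * exp (- y)"
      by (simp add: y_def flip: exp_add)
    also have "(2 * l) ^ n * (D * (exp (- y) * exp (- y))) = D * 2 ^ n * ((l ^ n * exp (- y)) * exp (- y))"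
      by (simp add: power_mult_distrib)
    also have "\<dots> \<le> D * 2 ^ n * ((((2 / (b * \<gamma>)) powr (1 / \<gamma>)) ^ n * G n) * (2 / b * q ^ k))"
      using D by (intro mult_left_mono mult_mono 1 2) (auto simp: G_def)
    also have "\<dots> = (D * (2 / b) * Q ^ n * G n) * q ^ k"
      by (simp add: Q_def power_mult_distrib)
    finally show ?thesis .
  qed
  have geo: "summable (\<lambda>k. q ^ k)" "(\<Sum>k. q ^ k) = 1 / (1 - q)"
    using q by (auto intro: summable_geometric suminf_geometric)
  have sm_Suc: "summable (\<lambda>k. (2 ^ Suc k) ^ n * norm (E (dyadic (Suc k)) x))" if "n \<ge> 1" for n
    by (rule summable_comparison_test'[OF summable_mult[OF geo(1), of "D * (2 / b) * Q ^ n * G n"], of 0])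
       (use term_le[OF that] in simp)
  have sm: "summable (\<lambda>k. (2 ^ k) ^ n * norm (E (dyadic k) x))" if "n \<ge> 1" for n
    using sm_Suc[OF that] by (subst summable_Suc_iff[symmetric])
  define W where "W = D * (2 / b) * (1 / (1 - q))"
  have W: "W \<ge> 0" using D b q by (simp add: W_def)
  \<comment> \<open>The prefactor is not itself an \<open>n\<close>-th power; adding
    \<open>1\<close> makes the base at least \<open>1\<close>, so for \<open>n \<ge> 1\<close> its
    \<open>n\<close>-th power dominates it. \<open>max 1 Q\<close> lets the contribution of window
    \<open>0\<close> fit the same bound.\<close>
  define R where "R = (norm x + W + 1) * max 1 Q"
  have R: "R > 0" using W by (auto simp: R_def intro!: mult_pos_pos add_nonneg_pos)
  have "norm (app (A ^^ n) x) \<le> R ^ n * G n" if n: "n \<ge> 1" for n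
  proof -
    have G: "G n \<ge> 1"
      using n \<gamma> by (auto simp: G_def intro!: ge_one_powr_ge_zero)
    have mQ: "max 1 Q ^ n \<ge> 1" "Q ^ n \<le> max 1 Q ^ n"
      using Q by (auto intro: one_le_power power_mono)
    have "norm (app (A ^^ n) x) \<le> (\<Sum>k. (2 ^ k) ^ n * norm (E (dyadic k) x))"
      by (rule relpow_dyadic(2)[OF sm n])
    also have "\<dots> = norm (E (dyadic 0) x) + (\<Sum>k. (2 ^ Suc k) ^ n * norm (E (dyadic (Suc k)) x))"
      using suminf_split_head[OF sm[OF n]] by simp
    also have "\<dots> \<le> norm x + (\<Sum>k. (D * (2 / b) * Q ^ n * G n) * q ^ k)"
      by (intro add_mono norm_proj_le dyadic_borel suminf_le term_le n sm_Suc summable_mult geo)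
    also have "\<dots> = norm x * (1 * 1) + W * (Q ^ n * G n)"
      unfolding suminf_mult[OF geo(1)] geo(2) by (simp add: W_def)
    also have "\<dots> \<le> norm x * (max 1 Q ^ n * G n) + W * (max 1 Q ^ n * G n)"
      using G mQ W Q by (intro add_mono mult_left_mono mult_mono) auto
    also have "\<dots> = (norm x + W) * (max 1 Q ^ n * G n)"
      by (simp add: distrib_right)
    also have "\<dots> \<le> (norm x + W + 1) ^ n * (max 1 Q ^ n * G n)"
    proof (rule mult_right_mono)
      have "norm x + W \<le> (norm x + W + 1) ^ 1" by simp
      also have "\<dots> \<le> (norm x + W + 1) ^ n"
        using n W by (intro power_increasing) auto
      finally show "norm x + W \<le> (norm x + W + 1) ^ n" .
    qed (use G mQ in auto)
    also have "\<dots> = R ^ n * G n"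
      by (simp add: R_def power_mult_distrib)
    finally show ?thesis .
  qed
  then show ?thesis
    using R relpow_dyadic(1)[OF sm] unfolding gevrey_def G_def by blast
qed

end

theorem theorem2p5:
  fixes A :: "'h::{real_inner, complete_space} operator"
    and c \<alpha> :: real and u\<^sub>0 u\<^sub>1 :: 'h and u :: "real \<Rightarrow> 'h"
  assumes "self_adjoint A" and "positive_operator A"
    and "c > 0" and "0 < \<alpha>" and "\<alpha> < 1"
    and "u\<^sub>0 \<in> energy_space A"
    and "energy_solution A c \<alpha> u\<^sub>0 u\<^sub>1 u"
  shows "\<forall>t>0. u t \<in> gevrey A (max (1 / \<alpha>) (1 / (1 - \<alpha>)))"
proof (intro allI impI)
  fix t :: real assume t: "t > 0"
  \<comment> \<open>\<open>frac_power\<close> quantifies existentially over spectral measures, so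
    any element of the energy space yields one.\<close>
  obtain E where E: "is_spectral_measure_of E A"
    using assms(6) unfolding energy_space_def frac_power_def by blast
  interpret positive_spectral E A
    using E assms(1,2) by unfold_locales (auto simp: is_spectral_measure_of_def)
  define \<gamma> where "\<gamma> = min \<alpha> (1 - \<alpha>)"
  define \<rho> where "\<rho> = min (1/2) (c / (2 * (1 + 2 * c\<^sup>2)))"
  have "1 + 2 * c\<^sup>2 > 0"
    using zero_le_power2[of c] by linarith
  then have \<rho>: "\<rho> > 0"
    using assms(3) by (simp add: \<rho>_def)
  define K where "K = (norm u\<^sub>1)\<^sup>2 + 2 * (norm u\<^sub>0)\<^sup>2"
  have K: "K \<ge> 0" by (simp add: K_def)
  have "norm (E (dyadic (Suc k)) (u t)) \<le> sqrt (3 * K) * exp (- (\<rho> * t / 3) * (2 ^ k) powr \<gamma>)" for k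
  \<comment> \<open>\<open>window_decay\<close> bounds the square with \<open>l = 2 ^ k\<close>; the
    square root halves its rate \<open>2 * \<rho> * t / 3\<close> to
    \<open>\<rho> * t / 3\<close>.\<close>
  proof (rule power2_le_imp_le)
    have "(norm (E (dyadic (Suc k)) (u t)))\<^sup>2 \<le>
        3 * exp (- (2 * (\<rho> * (2 ^ k) powr \<gamma>) / 3) * t) * K"
      unfolding \<rho>_def \<gamma>_def K_def using assms t dyadic_Suc_subset by (intro window_decay) auto
    also have "exp (- (2 * (\<rho> * (2 ^ k) powr \<gamma>) / 3) * t) = (exp (- (\<rho> * t / 3) * (2 ^ k) powr \<gamma>))\<^sup>2"
      by (simp add: power2_eq_square flip: exp_add)
    finally show "(norm (E (dyadic (Suc k)) (u t)))\<^sup>2 \<le> (sqrt (3 * K) * exp (- (\<rho> * t / 3) * (2 ^ k) powr \<gamma>))\<^sup>2"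
      using K by (simp add: power_mult_distrib mult_ac)
  qed (simp add: K)
  then have "u t \<in> gevrey A (1 / \<gamma>)"
    by (rule gevrey_of_dyadic_decay) (use t \<rho> assms(4,5) in \<open>auto simp: \<gamma>_def\<close>)
  also have "1 / \<gamma> = max (1 / \<alpha>) (1 / (1 - \<alpha>))"
    using assms(4,5) by (auto simp: \<gamma>_def min_def max_def field_simps)
  finally show "u t \<in> gevrey A (max (1 / \<alpha>) (1 / (1 - \<alpha>)))" .
qed

end
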